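(* Let $n\ge1$, let $\mu$ be a partition with $\ell(\mu)\le 2n$, and let $\mathbf v=(v_1,v_2,\ldots)$ be commuting indeterminates. Let $H^{(2n)}_\mu=\bigl[h_{j-i-\mu_{2n-i+1}}\bigr]_{1\le i\le 2n,\ j\ge1}$, and let $\Omega(\mathbf v)$ be the infinite skew-symmetric matrix (rows and columns indexed by $1,2,3,\dots$) with $\Omega(\mathbf v)_{i,i+1}=v_i$, $\Omega(\mathbf v)_{i+1,i}=-v_i$ for $i\ge1$ and all other entries $0$. Then $$\operatorname{Pf}\left(H^{(2n)}_\mu\,\Omega(\mathbf v)\,\bigl(H^{(2n)}_\mu\bigr)^{\mathsf T}\right)=\sum_{0\le a_1\le\cdots\le a_n}s_{(a_n^2,a_{n-1}^2,\ldots,a_1^2)/\mu}\prod_{r=1}^n v_{a_r+2r-1},$$ where the sum is over all weakly increasing $n$-tuples of nonnegative integers.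
   Context: $h_k$ is the $k$-th complete homogeneous symmetric function, with $h_0=1$ and $h_k=0$ for $k<0$. $s_{\lambda/\mu}$ is the skew Schur function, with $s_{\lambda/\mu}=0$ if $\mu\not\subseteq\lambda$. $\mu_i$ is the $i$-th part of $\mu$ (zero for $i>\ell(\mu)$), $\ell(\mu)$ is the number of nonzero parts, and $a^2$ in a partition means the part $a$ repeated twice. The Pfaffian of a $2n\times2n$ skew-symmetric matrix $M$ is $\operatorname{Pf}(M)=\frac{1}{2^n n!}\sum_{\sigma\in\mathfrak S_{2n}}\mathrm{sgn}(\sigma)\prod_{i=1}^nM_{\sigma(2i-1),\sigma(2i)}$. All infinite sums (including those in the matrix product) are interpreted coefficientwise with respect to the usual grading of the ring of symmetric functions, i.e. in the degree completion of the ring of symmetric functions with coefficients in polynomials in $v_1,v_2,\ldots$; in each fixed degree only finitely many terms are nonzero. *)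

theory Defs
  imports
    Complex_Main
    "HOL-Library.Multiset"
    "HOL-Library.Poly_Mapping"
    "HOL-Library.FuncSet"
    "HOL-Combinatorics.Permutations"
begin

section \<open>Formal power series in infinitely many variables\<close>

text \<open>
  The degree completion of the ring of symmetric functions is used inside the ring of all formal
  power series in variables \<open>x\<^sub>0, x\<^sub>1, x\<^sub>2, \<dots>\<close>.  A monomial is a finite multiset of variable
  indices, so its degree is its size.  A series is an arbitrary function from monomials to
  coefficients.
\<close>

typedef 'a mps = "UNIV :: (nat multiset \<Rightarrow> 'a) set"
  morphisms mcoeff Abs_mps ..

lemma mcoeff_Abs_mps [simp]: "mcoeff (Abs_mps f) = f"
  by (simp add: Abs_mps_inverse)

lemma mps_eqI: "(\<And>m. mcoeff f m = mcoeff g m) \<Longrightarrow> f = g"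
  by (metis ext mcoeff_inject)

lemma finite_submultisets [simp]: "finite {a. a \<subseteq># (m :: 'b multiset)}"
proof (induction m)
  case empty
  then show ?case by simp
next
  case (add x m)
  have "{a. a \<subseteq># add_mset x m} \<subseteq> {a. a \<subseteq># m} \<union> add_mset x ` {a. a \<subseteq># m}"
  proof
    fix a assume a: "a \<in> {a. a \<subseteq># add_mset x m}"
    show "a \<in> {a. a \<subseteq># m} \<union> add_mset x ` {a. a \<subseteq># m}"
    proof (cases "x \<in># a")
      case True
      then obtain b where b: "a = add_mset x b" by (metis mset_add)
      with a have "b \<subseteq># m" by simp
      with b show ?thesis by blast
    next
      case False
      with a have "a \<subseteq># m"
        by (metis diff_single_trivial diff_union_single_conv add_mset_remove_trivial
            mem_Collect_eq subset_eq_diff_conv add_mset_add_single)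
      then show ?thesis by blast
    qed
  qed
  with add show ?case by (meson finite_UnI finite_imageI finite_subset)
qed

instantiation mps :: (comm_ring_1) comm_ring_1
begin

definition "0 = Abs_mps (\<lambda>m. 0)"
definition "1 = Abs_mps (\<lambda>m. if m = {#} then 1 else 0)"
definition "f + g = Abs_mps (\<lambda>m. mcoeff f m + mcoeff g m)"
definition "f - g = Abs_mps (\<lambda>m. mcoeff f m - mcoeff g m)"
definition "- f = Abs_mps (\<lambda>m. - mcoeff f m)"
definition "f * g = Abs_mps (\<lambda>m. \<Sum>a | a \<subseteq># m. mcoeff f a * mcoeff g (m - a))"

instance
proof
  fix f g h :: "'a mps"
  show "f + g + h = f + (g + h)" "f + g = g + f" "0 + f = f" "- f + f = 0" "f - g = f + - g"
    by (simp_all add: plus_mps_def zero_mps_def uminus_mps_def minus_mps_def algebra_simps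
        mcoeff_inverse)
  have "mcoeff (0 :: 'a mps) {#} \<noteq> mcoeff 1 {#}"
    by (simp add: zero_mps_def one_mps_def)
  then show "(0 :: 'a mps) \<noteq> 1" by auto
  show "(f + g) * h = f * h + g * h"
    by (simp add: plus_mps_def times_mps_def sum.distrib algebra_simps)
  show "f * g = g * f"
  proof (rule mps_eqI)
    fix m
    show "mcoeff (f * g) m = mcoeff (g * f) m"
      unfolding times_mps_def mcoeff_Abs_mps
      by (rule sum.reindex_bij_witness[of _ "\<lambda>a. m - a" "\<lambda>a. m - a"])
         (auto simp: mult.commute subset_mset.diff_diff_right)
  qed
  show "1 * f = f"
  proof (rule mps_eqI)
    fix m
    have "mcoeff (1 * f) m = (\<Sum>a | a \<subseteq># m. if a = {#} then mcoeff f m else 0)"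
      unfolding times_mps_def one_mps_def mcoeff_Abs_mps by (rule sum.cong) auto
    also have "\<dots> = mcoeff f m" by (subst sum.delta) auto
    finally show "mcoeff (1 * f) m = mcoeff f m" .
  qed
  show "f * g * h = f * (g * h)"
  proof (rule mps_eqI)
    fix m
    have "mcoeff (f * g * h) m =
      (\<Sum>(a, b) \<in> (SIGMA a:{a. a \<subseteq># m}. {b. b \<subseteq># a}).
         mcoeff f b * mcoeff g (a - b) * mcoeff h (m - a))"
      unfolding times_mps_def mcoeff_Abs_mps by (simp add: sum.Sigma sum_distrib_right)
    also have "\<dots> = (\<Sum>(b, c) \<in> (SIGMA b:{b. b \<subseteq># m}. {c. c \<subseteq># m - b}).
         mcoeff f b * (mcoeff g c * mcoeff h (m - b - c)))"
    proof (rule sum.reindex_bij_witness[of _ "\<lambda>(b, c). (b + c, b)" "\<lambda>(a, b). (b, a - b)"],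
        goal_cases)
      case (1 x) then show ?case by (auto simp: subset_mset.diff_add)
    next
      case (2 x)
      then obtain a b where x: "x = (a, b)" "a \<subseteq># m" "b \<subseteq># a" by auto
      then have "b \<subseteq># m" by (meson subset_mset.order_trans)
      moreover have "a - b \<subseteq># m - b"
        using x by (simp add: subset_eq_diff_conv subset_mset.diff_add)
      ultimately show ?case using x by simp
    next
      case (3 x) then show ?case by auto
    next
      case (4 x)
      then obtain b c where x: "x = (b, c)" "b \<subseteq># m" "c \<subseteq># m - b" by auto
      then have "b + c \<subseteq># m"
        by (simp add: subset_mset.le_diff_conv2 add.commute)
      with x show ?case by simp
    next
      case (5 x)
      then obtain a b where x: "x = (a, b)" "a \<subseteq># m" "b \<subseteq># a" by auto
      then have "m - b - (a - b) = m - a"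
        by (metis diff_diff_add_mset subset_mset.add_diff_inverse)
      with x show ?case by (simp add: mult.assoc)
    qed
    also have "\<dots> = mcoeff (f * (g * h)) m"
      unfolding times_mps_def mcoeff_Abs_mps by (simp add: sum.Sigma sum_distrib_left)
    finally show "mcoeff (f * g * h) m = mcoeff (f * (g * h)) m" .
  qed
qed

end

definition const_mps :: "'a::comm_ring_1 \<Rightarrow> 'a mps" where
  "const_mps c = Abs_mps (\<lambda>m. if m = {#} then c else 0)"

lemma mcoeff_0 [simp]: "mcoeff 0 m = 0"
  by (simp add: zero_mps_def)

lemma mcoeff_mult: "mcoeff (f * g) m = (\<Sum>a | a \<subseteq># m. mcoeff f a * mcoeff g (m - a))"
  by (simp add: times_mps_def)

lemma mcoeff_mult_const: "mcoeff (f * const_mps c) m = mcoeff f m * c"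
proof -
  have "mcoeff (f * const_mps c) m = (\<Sum>a | a \<subseteq># m. if a = m then mcoeff f m * c else 0)"
    unfolding mcoeff_mult const_mps_def mcoeff_Abs_mps
    by (rule sum.cong) (auto simp: Diff_eq_empty_iff_mset subset_mset.antisym)
  also have "\<dots> = mcoeff f m * c" by (subst sum.delta) auto
  finally show ?thesis .
qed

lemma const_mps_1: "const_mps 1 = 1"
  by (simp add: const_mps_def one_mps_def)

lemma const_mps_mult: "const_mps (c * d) = const_mps c * const_mps d"
  by (rule mps_eqI) (simp add: mcoeff_mult_const, simp add: const_mps_def)

lemma const_mps_prod: "const_mps (\<Prod>i\<in>A. f i) = (\<Prod>i\<in>A. const_mps (f i))"
  by (induction A rule: infinite_finite_induct) (simp_all add: const_mps_1 const_mps_mult)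

text \<open>
  Infinite sums are coefficientwise.  They are meant for families satisfying
  \<open>degreewise_finite\<close>; otherwise a coefficient with infinitely many nonzero contributions
  is set to \<open>0\<close>.
\<close>

definition degreewise_finite :: "('i \<Rightarrow> 'a::comm_ring_1 mps) \<Rightarrow> 'i set \<Rightarrow> bool" where
  "degreewise_finite f I \<longleftrightarrow> (\<forall>d. finite {i \<in> I. \<exists>m. size m = d \<and> mcoeff (f i) m \<noteq> 0})"

definition inf_sum :: "('i \<Rightarrow> 'a::comm_ring_1 mps) \<Rightarrow> 'i set \<Rightarrow> 'a mps" where
  "inf_sum f I = Abs_mps (\<lambda>m. \<Sum>i | i \<in> I \<and> mcoeff (f i) m \<noteq> 0. mcoeff (f i) m)"

section \<open>Coefficients in the polynomial ring in the indeterminates \<open>v\<close>\<close>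

text \<open>
  Rational scalars are used because the definition of the Pfaffian divides by \<open>2 ^ n * n!\<close>.
\<close>

type_synonym vpoly = "(nat \<Rightarrow>\<^sub>0 nat) \<Rightarrow>\<^sub>0 rat"
type_synonym symfun = "vpoly mps"

definition vvar :: "nat \<Rightarrow> symfun" where
  "vvar k = const_mps (Poly_Mapping.single (Poly_Mapping.single k 1) 1)"

definition scalar :: "rat \<Rightarrow> symfun" where
  "scalar c = const_mps (Poly_Mapping.single 0 c)"

section \<open>Partitions, complete homogeneous and skew Schur functions\<close>

text \<open>Trailing zeros are allowed; only the parts, extended by zeros, matter.\<close>

definition is_partition :: "nat list \<Rightarrow> bool" where
  "is_partition \<mu> \<longleftrightarrow> sorted_wrt (\<ge>) \<mu>"

definition part :: "nat list \<Rightarrow> nat \<Rightarrow> nat" where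
  "part \<mu> i = (if 1 \<le> i \<and> i \<le> length \<mu> then \<mu> ! (i - 1) else 0)"

definition num_parts :: "nat list \<Rightarrow> nat" where
  "num_parts \<mu> = card {i. part \<mu> i \<noteq> 0}"

definition hsym :: "int \<Rightarrow> symfun" where
  "hsym k = Abs_mps (\<lambda>m. if int (size m) = k then 1 else 0)"

definition skew_diagram :: "nat list \<Rightarrow> nat list \<Rightarrow> (nat \<times> nat) set" where
  "skew_diagram lam \<mu> = {(i, j). 1 \<le> i \<and> part \<mu> i < j \<and> j \<le> part lam i}"

text \<open>
  Semistandard tableaux of a skew shape.  The entries are variable indices and hence start at
  \<open>0\<close>; outside the diagram a tableau is \<open>undefined\<close>, so that tableaux are not counted repeatedly.
\<close>

definition ssyt :: "nat list \<Rightarrow> nat list \<Rightarrow> (nat \<times> nat \<Rightarrow> nat) set" where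
  "ssyt lam \<mu> = {T \<in> extensional (skew_diagram lam \<mu>).
     (\<forall>i j. (i, j) \<in> skew_diagram lam \<mu> \<and> (i, Suc j) \<in> skew_diagram lam \<mu>
        \<longrightarrow> T (i, j) \<le> T (i, Suc j)) \<and>
     (\<forall>i j. (i, j) \<in> skew_diagram lam \<mu> \<and> (Suc i, j) \<in> skew_diagram lam \<mu>
        \<longrightarrow> T (i, j) < T (Suc i, j))}"

definition skew_schur :: "nat list \<Rightarrow> nat list \<Rightarrow> symfun" where
  "skew_schur lam \<mu> =
    (if \<forall>i. part \<mu> i \<le> part lam i
     then Abs_mps (\<lambda>m. of_nat (card {T \<in> ssyt lam \<mu>.
            image_mset T (mset_set (skew_diagram lam \<mu>)) = m}))
     else 0)"

lemma finite_skew_diagram [simp]: "finite (skew_diagram lam \<mu>)"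
proof -
  have "part lam i \<le> sum_list lam" for i
    by (auto simp: part_def intro: elem_le_sum_list)
  moreover have "part lam i = 0" if "i > length lam" for i
    using that by (simp add: part_def)
  ultimately have "skew_diagram lam \<mu> \<subseteq> {0..length lam} \<times> {0..sum_list lam}"
    unfolding skew_diagram_def
    by (smt (verit, best) atLeastAtMost_iff case_prodE dual_order.trans le_zero_eq mem_Collect_eq
        mem_Sigma_iff not_le_imp_less not_less_zero subsetI zero_le)
  then show ?thesis by (rule finite_subset) simp
qed

lemma finite_ssyt_content:
  "finite {T \<in> ssyt lam \<mu>. image_mset T (mset_set (skew_diagram lam \<mu>)) = m}"
proof (rule finite_subset)
  show "{T \<in> ssyt lam \<mu>. image_mset T (mset_set (skew_diagram lam \<mu>)) = m}
        \<subseteq> (\<Pi>\<^sub>E c \<in> skew_diagram lam \<mu>. set_mset m)"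
    by (auto simp: ssyt_def PiE_def)
  show "finite (\<Pi>\<^sub>E c \<in> skew_diagram lam \<mu>. set_mset m)"
    by (intro finite_PiE) auto
qed

lemma skew_schur_homogeneous:
  assumes "mcoeff (skew_schur lam \<mu>) m \<noteq> 0"
  shows "size m = card (skew_diagram lam \<mu>)"
proof (rule ccontr)
  assume "size m \<noteq> card (skew_diagram lam \<mu>)"
  then have empty: "{T \<in> ssyt lam \<mu>. image_mset T (mset_set (skew_diagram lam \<mu>)) = m} = {}"
    by auto
  have "mcoeff (skew_schur lam \<mu>) m = 0"
    by (simp only: skew_schur_def if_distrib[of "\<lambda>f. mcoeff f m"] mcoeff_Abs_mps mcoeff_0 empty)
       simp
  with assms show False by simp
qed

section \<open>Infinite matrices and Pfaffians\<close>

text \<open>Rows and columns of all matrices are indexed from \<open>1\<close>.\<close>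

type_synonym mat = "nat \<Rightarrow> nat \<Rightarrow> symfun"

definition mat_mul :: "mat \<Rightarrow> mat \<Rightarrow> mat" where
  "mat_mul A B = (\<lambda>i j. inf_sum (\<lambda>k. A i k * B k j) {1..})"

definition mat_transpose :: "mat \<Rightarrow> mat" where
  "mat_transpose A = (\<lambda>i j. A j i)"

definition Hmat :: "nat \<Rightarrow> nat list \<Rightarrow> mat" where
  "Hmat N \<mu> = (\<lambda>i j. hsym (int j - int i - int (part \<mu> (N - i + 1))))"

definition Omega :: mat where
  "Omega = (\<lambda>i j. if j = i + 1 then vvar i else if i = j + 1 then - vvar j else 0)"

definition pfaffian :: "nat \<Rightarrow> mat \<Rightarrow> symfun" where
  "pfaffian n M = scalar (1 / (2 ^ n * fact n)) *
     (\<Sum>\<sigma> | \<sigma> permutes {1..2 * n}.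
        of_int (sign \<sigma>) * (\<Prod>i = 1..n. M (\<sigma> (2 * i - 1)) (\<sigma> (2 * i))))"

text \<open>The tuple \<open>(a\<^sub>1, \<dots>, a\<^sub>n)\<close>, as a list, is sent to \<open>(a\<^sub>n, a\<^sub>n, \<dots>, a\<^sub>1, a\<^sub>1)\<close>.\<close>

definition doubled :: "nat list \<Rightarrow> nat list" where
  "doubled a = concat (map (\<lambda>x. [x, x]) (rev a))"

section \<open>The infinite sums are well defined\<close>

lemma Hmat_Omega_degreewise_finite: "degreewise_finite (\<lambda>k. Hmat N \<mu> i k * Omega k l) {1..}"
  unfolding degreewise_finite_def
proof
  fix d
  have "{k \<in> {1..}. \<exists>m. size m = d \<and> mcoeff (Hmat N \<mu> i k * Omega k l) m \<noteq> 0} \<subseteq> {..l + 1}"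
    by (auto simp: Omega_def split: if_splits)
  then show "finite {k \<in> {1..}. \<exists>m. size m = d \<and> mcoeff (Hmat N \<mu> i k * Omega k l) m \<noteq> 0}"
    by (rule finite_subset) simp
qed

lemma mult_Hmat_transpose_degreewise_finite:
  "degreewise_finite (\<lambda>l. B i l * mat_transpose (Hmat N \<mu>) l j) {1..}"
  unfolding degreewise_finite_def
proof
  fix d
  have "l \<le> d + j + part \<mu> (N - j + 1)"
    if m: "size m = d" "mcoeff (B i l * mat_transpose (Hmat N \<mu>) l j) m \<noteq> 0" for l m
  proof -
    obtain a where a: "a \<subseteq># m" "mcoeff (mat_transpose (Hmat N \<mu>) l j) (m - a) \<noteq> 0"
    proof -
      from m(2) have "\<exists>a \<in> {a. a \<subseteq># m}.
          mcoeff (B i l) a * mcoeff (mat_transpose (Hmat N \<mu>) l j) (m - a) \<noteq> 0"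
        unfolding mcoeff_mult by (metis (no_types, lifting) sum.neutral)
      then show ?thesis using that by (metis mem_Collect_eq mult_zero_right)
    qed
    then have "int (size (m - a)) = int l - int j - int (part \<mu> (N - j + 1))"
      by (auto simp: mat_transpose_def Hmat_def hsym_def split: if_splits)
    moreover have "size (m - a) \<le> d"
      using m(1) by (metis diff_subset_eq_self size_mset_mono)
    ultimately show ?thesis by linarith
  qed
  then have "{l \<in> {1..}. \<exists>m. size m = d \<and> mcoeff (B i l * mat_transpose (Hmat N \<mu>) l j) m \<noteq> 0}
      \<subseteq> {..d + j + part \<mu> (N - j + 1)}"
    by blast
  then show "finite {l \<in> {1..}. \<exists>m. size m = d \<and>
      mcoeff (B i l * mat_transpose (Hmat N \<mu>) l j) m \<noteq> 0}"
    by (rule finite_subset) simp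
qed

lemma skew_schur_sum_degreewise_finite:
  "degreewise_finite
     (\<lambda>a. skew_schur (doubled a) \<mu> * (\<Prod>r = 1..n. vvar (a ! (r - 1) + 2 * r - 1)))
     {a. length a = n \<and> sorted a}"
  unfolding degreewise_finite_def
proof
  fix d
  let ?t = "\<lambda>a. skew_schur (doubled a) \<mu> * (\<Prod>r = 1..n. vvar (a ! (r - 1) + 2 * r - 1))"
  have "set a \<subseteq> {..d + part \<mu> 1}"
    if a: "length a = n" "sorted a" and m: "size m = d" "mcoeff (?t a) m \<noteq> 0" for a m
  proof (cases "a = []")
    case False
    obtain c where "(\<Prod>r = 1..n. vvar (a ! (r - 1) + 2 * r - 1)) = const_mps c"
      unfolding vvar_def const_mps_prod [symmetric] by blast
    with m(2) have "mcoeff (skew_schur (doubled a) \<mu>) m \<noteq> 0"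
      by (auto simp: mcoeff_mult_const)
    then have d: "d = card (skew_diagram (doubled a) \<mu>)"
      using m(1) skew_schur_homogeneous by metis
    have p: "part (doubled a) 1 = last a"
      using False by (cases a rule: rev_cases) (auto simp: doubled_def part_def)
    have "Pair 1 ` {part \<mu> 1<..last a} \<subseteq> skew_diagram (doubled a) \<mu>"
      using p by (auto simp: skew_diagram_def)
    then have "card (Pair (1::nat) ` {part \<mu> 1<..last a}) \<le> d"
      unfolding d by (intro card_mono) auto
    then have "last a \<le> d + part \<mu> 1"
      by (simp add: card_image inj_on_def)
    moreover have "x \<le> last a" if "x \<in> set a" for x
      using that a(2) False by (cases a rule: rev_cases) (auto simp: sorted_append)
    ultimately show ?thesis by force
  qed simp
  then have "{a \<in> {a. length a = n \<and> sorted a}. \<exists>m. size m = d \<and> mcoeff (?t a) m \<noteq> 0}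
      \<subseteq> {a. set a \<subseteq> {..d + part \<mu> 1} \<and> length a = n}"
    by blast
  then show "finite {a \<in> {a. length a = n \<and> sorted a}. \<exists>m. size m = d \<and> mcoeff (?t a) m \<noteq> 0}"
    by (rule finite_subset) (simp add: finite_lists_length_eq)
qed

end

theory Submission
  imports Defs
begin

text \<open>
  The theorem is a minor summation formula.  Put \<open>H = Hmat (2 * n) \<mu>\<close>.  Since \<open>Omega\<close> has entries only next
  to the diagonal, each entry of the product \<open>H * Omega * H\<^sup>T\<close> is \<open>A p q - A q p\<close> with
  \<open>A p q = (\<Sum>k. v\<^sub>k * H p k * H q (k + 1))\<close>.  In the signed sum over permutations that defines the Pfaffian,
  antisymmetrizing \<open>A\<close> only produces a factor \<open>2 ^ n\<close> (\<open>signed_sum_antisymmetrized\<close>).  Expanding the products of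
  sums then gives, for every choice \<open>\<kappa> 1, \<dots>, \<kappa> n\<close> of summation indices, the monomial
  \<open>v\<^bsub>\<kappa> 1\<^esub> \<cdots> v\<^bsub>\<kappa> n\<^esub>\<close> times the minor of \<open>H\<close> in the columns
  \<open>\<kappa> 1, \<kappa> 1 + 1, \<dots>, \<kappa> n, \<kappa> n + 1\<close> (\<open>signed_sum_pair_minors\<close>).  The minor vanishes when a column is
  repeated and does not depend on the order of the pairs, so the sum is \<open>n!\<close> times the sum over increasing
  sequences with gaps at least \<open>2\<close>.  Such sequences are \<open>\<kappa> r = a\<^sub>r + 2 r - 1\<close> with
  \<open>0 \<le> a\<^sub>1 \<le> \<dots> \<le> a\<^sub>n\<close>, and the corresponding minor is, after reversing rows and columns, the Jacobi-Trudi
  determinant of the skew Schur function of \<open>(a\<^sub>n, a\<^sub>n, \<dots>, a\<^sub>1, a\<^sub>1) / \<mu>\<close>.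

  The Jacobi-Trudi formula is proved in finitely many variables, by induction on their number
  (\<open>jacobi_trudi\<close>).  Deleting the largest letter from a tableau removes a horizontal strip
  (\<open>tableau_sum_branching\<close>), and on the side of the determinant the same sum over strips appears when a suitable
  multiple of the next row is subtracted from each row.

  Infinite sums and infinitely many variables are handled one monomial \<open>M\<close> at a time: the relation
  \<open>agree M\<close> compares two series at the divisors of \<open>M\<close> only, is compatible with sums and products, and
  makes all but finitely many terms and variables irrelevant.
\<close>

section \<open>Determinants over finite index sets\<close>

text \<open>
  Rows and columns are indexed by a set of naturals and not by a type, because the size varies with \<open>n\<close>.
  In the application the set is \<open>{1..2 * n}\<close>, which matches the numbering of the parts of a partition and
  the indices permuted in the Pfaffian.
\<close>
definition leibniz_det :: "nat set \<Rightarrow> (nat \<Rightarrow> nat \<Rightarrow> 'a::comm_ring_1) \<Rightarrow> 'a" where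
  "leibniz_det S f = (\<Sum>\<sigma> | \<sigma> permutes S. of_int (sign \<sigma>) * (\<Prod>i\<in>S. f i (\<sigma> i)))"

lemma leibniz_det_cong:
  assumes "\<And>i j. i \<in> S \<Longrightarrow> j \<in> S \<Longrightarrow> f i j = g i j"
  shows "leibniz_det S f = leibniz_det S g"
  unfolding leibniz_det_def
  by (intro sum.cong refl arg_cong2[where f = "(*)"] prod.cong)
     (auto intro!: assms simp: permutes_in_image)

lemma sign_compose_transpose:
  assumes "finite S" "\<sigma> permutes S" "a \<noteq> b"
  shows "sign (\<sigma> \<circ> transpose a b) = - sign \<sigma>"
proof -
  have "permutation \<sigma>" using assms(1,2) permutation_permutes by blast
  then show ?thesis using assms(3)
    by (simp add: sign_compose permutation_swap_id sign_swap_id)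
qed

text \<open>
  Everything alternating about determinants and Pfaffians comes from composing the summation
  permutation with one fixed transposition.
\<close>
lemma signed_sum_transpose:
  fixes F :: "(nat \<Rightarrow> nat) \<Rightarrow> 'a::comm_ring_1"
  assumes "finite S" "a \<in> S" "b \<in> S" "a \<noteq> b"
  shows "(\<Sum>\<sigma> | \<sigma> permutes S. of_int (sign \<sigma>) * F (\<sigma> \<circ> transpose a b))
       = - (\<Sum>\<sigma> | \<sigma> permutes S. of_int (sign \<sigma>) * F \<sigma>)"
proof -
  have t: "transpose a b permutes S"
    using assms by (simp add: permutes_swap_id)
  have "(\<Sum>\<sigma> | \<sigma> permutes S. of_int (sign \<sigma>) * F (\<sigma> \<circ> transpose a b))
      = (\<Sum>\<sigma> | \<sigma> permutes S. - (of_int (sign \<sigma>) * F \<sigma>))"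
    by (rule sum.reindex_bij_witness[of _ "\<lambda>\<sigma>. \<sigma> \<circ> transpose a b" "\<lambda>\<sigma>. \<sigma> \<circ> transpose a b"])
       (auto simp: comp_assoc sign_compose_transpose[OF assms(1) _ assms(4)]
             intro: permutes_compose[OF t])
  then show ?thesis by (simp add: sum_negf)
qed

text \<open>
  The even and the odd permutations are matched with each other by the transposition.  Cancelling
  them in pairs, instead of deriving that the sum equals its own negative, makes the lemma valid over
  every commutative ring.
\<close>
lemma signed_sum_eq_0:
  fixes F :: "(nat \<Rightarrow> nat) \<Rightarrow> 'a::comm_ring_1"
  assumes "finite S" "a \<in> S" "b \<in> S" "a \<noteq> b"
    and inv: "\<And>\<sigma>. \<sigma> permutes S \<Longrightarrow> F (\<sigma> \<circ> transpose a b) = F \<sigma>"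
  shows "(\<Sum>\<sigma> | \<sigma> permutes S. of_int (sign \<sigma>) * F \<sigma>) = 0"
proof -
  let ?P = "{\<sigma>. \<sigma> permutes S}"
  have t: "transpose a b permutes S"
    using assms by (simp add: permutes_swap_id)
  have fin: "finite ?P" using assms(1) by (rule finite_permutations)
  have sgn: "evenperm (\<sigma> \<circ> transpose a b) \<longleftrightarrow> \<not> evenperm \<sigma>" if "\<sigma> permutes S" for \<sigma>
    using sign_compose_transpose[OF assms(1) that assms(4)] by (auto simp: sign_def split: if_splits)
  have "(\<Sum>\<sigma>\<in>?P. of_int (sign \<sigma>) * F \<sigma>)
      = (\<Sum>\<sigma>\<in>{\<sigma> \<in> ?P. evenperm \<sigma>}. F \<sigma>) + (\<Sum>\<sigma>\<in>{\<sigma> \<in> ?P. \<not> evenperm \<sigma>}. - F \<sigma>)"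
    unfolding sum.inter_filter[OF fin] sum.distrib[symmetric]
    by (rule sum.cong) (auto simp: sign_def)
  also have "(\<Sum>\<sigma>\<in>{\<sigma> \<in> ?P. \<not> evenperm \<sigma>}. - F \<sigma>) = (\<Sum>\<sigma>\<in>{\<sigma> \<in> ?P. evenperm \<sigma>}. - F \<sigma>)"
    by (rule sum.reindex_bij_witness[of _ "\<lambda>\<sigma>. \<sigma> \<circ> transpose a b" "\<lambda>\<sigma>. \<sigma> \<circ> transpose a b"])
       (auto simp: comp_assoc sgn inv intro: permutes_compose[OF t])
  finally show ?thesis by (simp add: sum_negf)
qed

lemma prod_transpose_reindex:
  fixes g :: "nat \<Rightarrow> nat \<Rightarrow> 'a::comm_monoid_mult"
  assumes "a \<in> S" "b \<in> S"
  shows "(\<Prod>i\<in>S. g i (\<sigma> (transpose a b i))) = (\<Prod>i\<in>S. g (transpose a b i) (\<sigma> i))"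
  by (rule prod.reindex_bij_witness[of _ "transpose a b" "transpose a b"])
     (use assms in \<open>auto simp: transpose_def\<close>)

lemma leibniz_det_equal_rows:
  assumes "finite S" "a \<in> S" "b \<in> S" "a \<noteq> b" and eq: "\<And>j. j \<in> S \<Longrightarrow> f a j = f b j"
  shows "leibniz_det S f = 0"
  unfolding leibniz_det_def
proof (rule signed_sum_eq_0[OF assms(1-4)])
  fix \<sigma> assume s: "\<sigma> permutes S"
  have "(\<Prod>i\<in>S. f i ((\<sigma> \<circ> transpose a b) i)) = (\<Prod>i\<in>S. f (transpose a b i) (\<sigma> i))"
    using prod_transpose_reindex[OF assms(2,3)] by simp
  also have "\<dots> = (\<Prod>i\<in>S. f i (\<sigma> i))"
    by (rule prod.cong) (auto simp: transpose_def eq permutes_in_image[OF s])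
  finally show "(\<Prod>i\<in>S. f i ((\<sigma> \<circ> transpose a b) i)) = (\<Prod>i\<in>S. f i (\<sigma> i))" .
qed

lemma leibniz_det_zero_row:
  assumes "finite S" "a \<in> S" "\<And>j. j \<in> S \<Longrightarrow> f a j = 0"
  shows "leibniz_det S f = 0"
proof -
  have "(\<Prod>i\<in>S. f i (\<sigma> i)) = 0" if "\<sigma> permutes S" for \<sigma>
    using assms by (intro prod_zero bexI[of _ a]) (auto simp: permutes_in_image[OF that])
  then show ?thesis by (simp add: leibniz_det_def)
qed

lemma leibniz_det_swap_rows:
  assumes "finite S" "a \<in> S" "b \<in> S" "a \<noteq> b"
  shows "leibniz_det S (\<lambda>i. f (transpose a b i)) = - leibniz_det S f"
  unfolding leibniz_det_def
  using signed_sum_transpose[OF assms, of "\<lambda>\<sigma>. \<Prod>i\<in>S. f i (\<sigma> i)"]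
    prod_transpose_reindex[OF assms(2,3), of f]
  by simp

lemma leibniz_det_row_linear:
  assumes "finite S" "a \<in> S"
  shows "leibniz_det S (f(a := (\<lambda>j. u j - c * w j)))
       = leibniz_det S (f(a := u)) - c * leibniz_det S (f(a := w))"
proof -
  have split: "(\<Prod>i\<in>S. (f(a := z)) i (\<sigma> i)) = z (\<sigma> a) * (\<Prod>i\<in>S - {a}. f i (\<sigma> i))" for z \<sigma>
  proof -
    have "(\<Prod>i\<in>S - {a}. (f(a := z)) i (\<sigma> i)) = (\<Prod>i\<in>S - {a}. f i (\<sigma> i))"
      by (rule prod.cong) auto
    then show ?thesis by (simp add: prod.remove[OF assms])
  qed
  show ?thesis
    unfolding leibniz_det_def split sum_distrib_left sum_subtractf[symmetric]
    by (rule sum.cong) (auto simp: algebra_simps)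
qed

text \<open>
  The transition matrix is unipotent.  The rows are treated from the top down: when row \<open>i\<close> is
  changed, row \<open>i + 1\<close> is still the original one, so the correction term has two equal rows.  The
  row \<open>N + 1\<close> outside the matrix is set to zero so that the last row needs no exception.
\<close>
lemma leibniz_det_subtract_next_rows:
  assumes zero: "\<And>j. j \<in> {1..N} \<Longrightarrow> f (Suc N) j = 0"
  shows "leibniz_det {1..N} (\<lambda>i j. f i j - c i * f (Suc i) j) = leibniz_det {1..N} f"
proof -
  define g where "g k = (\<lambda>i. if i \<le> k then (\<lambda>j. f i j - c i * f (Suc i) j) else f i)" for k
  have step: "leibniz_det {1..N} (g (Suc k)) = leibniz_det {1..N} (g k)" if "k < N" for k
  proof -
    have a: "finite {1..N}" "Suc k \<in> {1..N}" using that by auto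
    have "g (Suc k) = (g k)(Suc k := (\<lambda>j. f (Suc k) j - c (Suc k) * f (Suc (Suc k)) j))"
      by (auto simp: g_def fun_eq_iff)
    then have "leibniz_det {1..N} (g (Suc k)) = leibniz_det {1..N} ((g k)(Suc k := f (Suc k)))
        - c (Suc k) * leibniz_det {1..N} ((g k)(Suc k := f (Suc (Suc k))))"
      by (simp only: leibniz_det_row_linear[OF a])
    moreover have "(g k)(Suc k := f (Suc k)) = g k" by (auto simp: g_def)
    moreover have "leibniz_det {1..N} ((g k)(Suc k := f (Suc (Suc k)))) = 0"
    proof (cases "Suc k = N")
      case True
      then show ?thesis using a zero by (intro leibniz_det_zero_row[OF a]) auto
    next
      case False
      then show ?thesis using that
        by (intro leibniz_det_equal_rows[of _ "Suc k" "Suc (Suc k)"]) (auto simp: g_def)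
    qed
    ultimately show ?thesis by simp
  qed
  have "leibniz_det {1..N} (g k) = leibniz_det {1..N} (g 0)" if "k \<le> N" for k
    using that
  proof (induction k)
    case (Suc k)
    then show ?case using step[of k] by simp
  qed simp
  from this[of N] have "leibniz_det {1..N} (g N) = leibniz_det {1..N} (g 0)" by blast
  also have "leibniz_det {1..N} (g N) = leibniz_det {1..N} (\<lambda>i j. f i j - c i * f (Suc i) j)"
    by (rule leibniz_det_cong) (auto simp: g_def)
  also have "leibniz_det {1..N} (g 0) = leibniz_det {1..N} f"
    by (rule leibniz_det_cong) (auto simp: g_def)
  finally show ?thesis .
qed

lemma leibniz_det_row_sums:
  assumes "finite S" "\<And>i. i \<in> S \<Longrightarrow> finite (B i)"
  shows "leibniz_det S (\<lambda>i j. \<Sum>k\<in>B i. w i k * g i k j)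
       = (\<Sum>\<kappa>\<in>PiE S B. (\<Prod>i\<in>S. w i (\<kappa> i)) * leibniz_det S (\<lambda>i j. g i (\<kappa> i) j))"
  unfolding leibniz_det_def
  by (simp add: prod_sum_PiE[OF assms] sum_distrib_left prod.distrib)
     (subst sum.swap, simp add: mult.left_commute)

lemma leibniz_det_conjugate:
  assumes "finite S" "\<rho> permutes S"
  shows "leibniz_det S (\<lambda>i j. f (\<rho> i) (\<rho> j)) = leibniz_det S f"
  unfolding leibniz_det_def
proof (rule sum.reindex_bij_witness[of _ "\<lambda>\<sigma>. inv \<rho> \<circ> \<sigma> \<circ> \<rho>" "\<lambda>\<sigma>. \<rho> \<circ> \<sigma> \<circ> inv \<rho>"], goal_cases)
  case (1 \<sigma>) then show ?case by (simp add: fun_eq_iff permutes_inverses[OF assms(2)])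
next
  case (2 \<sigma>) then show ?case using assms by (auto intro!: permutes_compose permutes_inv)
next
  case (3 \<sigma>) then show ?case by (simp add: fun_eq_iff permutes_inverses[OF assms(2)])
next
  case (4 \<sigma>) then show ?case using assms by (auto intro!: permutes_compose permutes_inv)
next
  case (5 \<sigma>)
  then have s: "\<sigma> permutes S" by simp
  have perm: "permutation \<sigma>" "permutation \<rho>" "permutation (inv \<rho>)"
    using s assms permutes_inv permutation_permutes by blast+
  have "sign (\<rho> \<circ> \<sigma> \<circ> inv \<rho>) = sign \<rho> * sign \<sigma> * sign \<rho>"
    using perm by (simp add: sign_compose permutation_compose sign_inverse)
  also have "\<dots> = sign \<sigma>" by (simp add: sign_def)
  finally have "sign (\<rho> \<circ> \<sigma> \<circ> inv \<rho>) = sign \<sigma>" .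
  moreover have "(\<Prod>i\<in>S. f i ((\<rho> \<circ> \<sigma> \<circ> inv \<rho>) i)) = (\<Prod>i\<in>S. f (\<rho> i) (\<rho> (\<sigma> i)))"
    using prod.permute[OF assms(2), of "\<lambda>i. f i ((\<rho> \<circ> \<sigma> \<circ> inv \<rho>) i)"]
    by (simp add: permutes_inverses[OF assms(2)])
  ultimately show ?case by simp
qed

section \<open>Tableaux with bounded entries\<close>

text \<open>
  The exponent is the multiset itself, which makes \<open>monom\<close> turn the content of a tableau into the
  monomial of that tableau.
\<close>
definition monom :: "nat multiset \<Rightarrow> 'a::comm_ring_1 mps" where
  "monom a = Abs_mps (\<lambda>m. if m = a then 1 else 0)"

lemma mcoeff_monom: "mcoeff (monom a) m = (if m = a then 1 else 0)"
  by (simp add: monom_def)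

lemma mcoeff_monom_mult: "mcoeff (monom a * f) m = (if a \<subseteq># m then mcoeff f (m - a) else 0)"
proof -
  have "mcoeff (monom a * f) m = (\<Sum>b | b \<subseteq># m. if b = a then mcoeff f (m - a) else 0)"
    unfolding mcoeff_mult by (rule sum.cong) (auto simp: mcoeff_monom)
  then show ?thesis by simp
qed

lemma monom_mult_monom: "monom a * monom b = monom (a + b)"
  by (rule mps_eqI) (auto simp: mcoeff_monom_mult mcoeff_monom subset_mset.le_iff_add)

lemma monom_empty [simp]: "monom {#} = 1"
  by (rule mps_eqI) (simp add: mcoeff_monom one_mps_def)

lemma replicate_mset_add: "replicate_mset (a + b) x = replicate_mset a x + replicate_mset b x"
  by (induction a) simp_all

lemma prod_monom_replicate:
  "(\<Prod>i\<in>A. monom (replicate_mset (e i) x)) = monom (replicate_mset (\<Sum>i\<in>A. e i) x)"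
  by (induction A rule: infinite_finite_induct)
     (simp_all add: monom_mult_monom replicate_mset_add)

lemma mcoeff_sum: "mcoeff (sum f A) m = (\<Sum>i\<in>A. mcoeff (f i) m)"
  by (induction A rule: infinite_finite_induct) (simp_all add: plus_mps_def)

text \<open>
  With only the variables \<open>x\<^sub>0, \<dots>, x\<^sub>p\<^sub>-\<^sub>1\<close> a finite set of cells has only finitely many tableaux.  Their generating
  function is then a finite sum in the ring and allows induction on \<open>p\<close>.
\<close>
definition tableaux :: "nat \<Rightarrow> (nat \<times> nat) set \<Rightarrow> (nat \<times> nat \<Rightarrow> nat) set" where
  "tableaux p D = {T \<in> extensional D. (\<forall>c\<in>D. T c < p) \<and>
     (\<forall>i j. (i, j) \<in> D \<and> (i, Suc j) \<in> D \<longrightarrow> T (i, j) \<le> T (i, Suc j)) \<and>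
     (\<forall>i j. (i, j) \<in> D \<and> (Suc i, j) \<in> D \<longrightarrow> T (i, j) < T (Suc i, j))}"

definition tableau_sum :: "nat \<Rightarrow> (nat \<times> nat) set \<Rightarrow> 'a::comm_ring_1 mps" where
  "tableau_sum p D = (\<Sum>T\<in>tableaux p D. monom (image_mset T (mset_set D)))"

definition rows_diagram :: "nat \<Rightarrow> (nat \<Rightarrow> nat) \<Rightarrow> (nat \<Rightarrow> nat) \<Rightarrow> (nat \<times> nat) set" where
  "rows_diagram N l m = (SIGMA i:{1..N}. {m i<..l i})"

lemma finite_rows_diagram [simp]: "finite (rows_diagram N l m)"
  by (simp add: rows_diagram_def)

lemma finite_tableaux [simp]:
  assumes "finite D"
  shows "finite (tableaux p D)"
proof (rule finite_subset)
  show "tableaux p D \<subseteq> (D \<rightarrow>\<^sub>E {..<p})"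
    by (auto simp: tableaux_def PiE_def)
  show "finite (D \<rightarrow>\<^sub>E {..<p})"
    using assms by (intro finite_PiE) auto
qed

text \<open>
  In one row of a tableau, the cells whose entry is less than \<open>p\<close> form such a set.
\<close>
lemma predecessor_closed_interval:
  fixes a w :: nat
  assumes "B \<subseteq> {a<..w}" and closed: "\<And>j. Suc j \<in> B \<Longrightarrow> a < j \<Longrightarrow> j \<in> B"
  shows "B = {a<..a + card B}"
proof (cases "B = {}")
  case False
  have fin: "finite B" using assms(1) by (rule finite_subset) simp
  define x where "x = Max B"
  have x: "x \<in> B" using fin False by (simp add: x_def)
  have down: "x - k \<in> B" if "a < x - k" for k
    using that
  proof (induction k)
    case (Suc k)
    then have "Suc (x - Suc k) = x - k" by simp
    then show ?case using Suc closed by (metis less_Suc_eq)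
  qed (simp add: x)
  have "j \<in> B" if "a < j" "j \<le> x" for j
    using down[of "x - j"] that by simp
  then have B: "B = {a<..x}"
    using assms(1) Max_ge[OF fin] by (auto simp: x_def subset_iff)
  moreover have "a < x" using x assms(1) by auto
  ultimately show ?thesis by simp
qed simp

text \<open>
  The branching rule.  The cells carrying the largest letter \<open>p\<close> sit at the ends of the rows, at most
  one in each column, that is, they form a horizontal strip.  Deleting them leaves a tableau in the
  smaller letters on the diagram between \<open>m\<close> and some \<open>\<nu>\<close>, where the strip condition is the interlacing
  \<open>l (i + 1) \<le> \<nu> i \<le> l i\<close>.  Conversely, any such strip can be filled with \<open>p\<close>.
\<close>
lemma tableau_sum_branching:
  assumes l: "\<And>i. i \<in> {1..N} \<Longrightarrow> l (Suc i) \<le> l i" "l (Suc N) = 0"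
    and m: "\<And>i. i \<in> {1..<N} \<Longrightarrow> m (Suc i) \<le> m i"
    and ml: "\<And>i. i \<in> {1..N} \<Longrightarrow> m i \<le> l i"
  shows "tableau_sum (Suc p) (rows_diagram N l m) =
    (\<Sum>\<nu> | \<nu> \<in> PiE {1..N} (\<lambda>i. {l (Suc i)..l i}) \<and> (\<forall>i\<in>{1..N}. m i \<le> \<nu> i).
       monom (replicate_mset (\<Sum>i\<in>{1..N}. l i - \<nu> i) p) * tableau_sum p (rows_diagram N \<nu> m))"
proof -
  let ?D = "rows_diagram N l m"
  let ?S = "{\<nu> \<in> PiE {1..N} (\<lambda>i. {l (Suc i)..l i}). \<forall>i\<in>{1..N}. m i \<le> \<nu> i}"
  define shape where
    "shape T = (\<lambda>i\<in>{1..N}. m i + card {j \<in> {m i<..l i}. T (i, j) < p})" for T :: "nat \<times> nat \<Rightarrow> nat"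
  define extend where
    "extend \<nu> T = (\<lambda>c\<in>?D. if c \<in> rows_diagram N \<nu> m then T c else p)"
    for \<nu> and T :: "nat \<times> nat \<Rightarrow> nat"
  have finS: "finite ?S" by (rule finite_subset[of _ "PiE {1..N} (\<lambda>i. {l (Suc i)..l i})"])
      (auto intro!: finite_PiE)
  have row: "{j \<in> {m i<..l i}. T (i, j) < p} = {m i<..shape T i}"
    if T: "T \<in> tableaux (Suc p) ?D" and i: "i \<in> {1..N}" for T i
  proof -
    have "{j \<in> {m i<..l i}. T (i, j) < p} = {m i<..m i + card {j \<in> {m i<..l i}. T (i, j) < p}}"
    proof (rule predecessor_closed_interval[where w = "l i"])
      fix j assume "Suc j \<in> {j \<in> {m i<..l i}. T (i, j) < p}" "m i < j"
      moreover from this have "T (i, j) \<le> T (i, Suc j)"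
        using T i by (auto simp: tableaux_def rows_diagram_def)
      ultimately show "j \<in> {j \<in> {m i<..l i}. T (i, j) < p}" by auto
    qed auto
    then show ?thesis using i by (simp add: shape_def)
  qed
  \<comment> \<open>The inner shape is recovered from the tableau as the set of cells with small entries.\<close>
  have shape_diagram: "rows_diagram N (shape T) m = {c \<in> ?D. T c < p}"
    if "T \<in> tableaux (Suc p) ?D" for T
  proof -
    have "rows_diagram N (shape T) m = (SIGMA i:{1..N}. {j \<in> {m i<..l i}. T (i, j) < p})"
      unfolding rows_diagram_def by (rule Sigma_cong[OF refl]) (rule row[OF that, symmetric])
    also have "\<dots> = {c \<in> ?D. T c < p}" by (auto simp: rows_diagram_def)
    finally show ?thesis .
  qed
  have shape_S: "shape T \<in> ?S" if T: "T \<in> tableaux (Suc p) ?D" for T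
  proof -
    have "l (Suc i) \<le> shape T i \<and> shape T i \<le> l i \<and> m i \<le> shape T i" if i: "i \<in> {1..N}" for i
    proof (intro conjI)
      show mi: "m i \<le> shape T i" using i by (simp add: shape_def)
      show "shape T i \<le> l i"
      proof (cases "m i < shape T i")
        case True
        then have "shape T i \<in> {m i<..shape T i}" by simp
        then show ?thesis unfolding row[OF T i, symmetric] by simp
      qed (use ml[OF i] in simp)
      show "l (Suc i) \<le> shape T i"
      proof (rule ccontr)
        assume less: "\<not> l (Suc i) \<le> shape T i"
        then have i': "i < N" using i l(2) by (cases "i = N") auto
        \<comment> \<open>A column with two cells of the strip would contain \<open>p\<close> and below it something larger.\<close>
        define j where "j = Suc (shape T i)"
        have j: "j \<le> l (Suc i)" "j \<le> l i" "m i < j" "m (Suc i) < j"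
          using less l(1)[OF i] mi m[of i] i i' by (auto simp: j_def)
        have "j \<notin> {m i<..shape T i}" by (simp add: j_def)
        then have "\<not> T (i, j) < p" unfolding row[OF T i, symmetric] using j by simp
        moreover have "T (i, j) < T (Suc i, j)" "T (Suc i, j) < Suc p"
          using T j i i' by (auto simp: tableaux_def rows_diagram_def)
        ultimately show False by simp
      qed
    qed
    then show ?thesis by (auto simp: shape_def)
  qed
  have bounds: "l (Suc i) \<le> \<nu> i" "\<nu> i \<le> l i" "m i \<le> \<nu> i" if "\<nu> \<in> ?S" "i \<in> {1..N}" for \<nu> i
    using that by (auto simp: PiE_iff)
  have sub: "rows_diagram N \<nu> m \<subseteq> ?D" if "\<nu> \<in> ?S" for \<nu>
    unfolding rows_diagram_def
  proof (rule Sigma_mono)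
    show "{m i<..\<nu> i} \<subseteq> {m i<..l i}" if "i \<in> {1..N}" for i
      using bounds(2)[OF \<open>\<nu> \<in> ?S\<close> that] by auto
  qed simp
  have extend_less: "{c \<in> ?D. extend \<nu> T c < p} = rows_diagram N \<nu> m"
    if "\<nu> \<in> ?S" "T \<in> tableaux p (rows_diagram N \<nu> m)" for \<nu> T
    using sub[OF that(1)] that(2) by (auto simp: extend_def tableaux_def)
  have extend_tableau: "extend \<nu> T \<in> tableaux (Suc p) ?D"
    if \<nu>: "\<nu> \<in> ?S" and T: "T \<in> tableaux p (rows_diagram N \<nu> m)" for \<nu> T
    unfolding tableaux_def
  proof (intro CollectI conjI allI impI ballI)
    show "extend \<nu> T \<in> extensional ?D" by (simp add: extend_def)
    show "extend \<nu> T c < Suc p" if "c \<in> ?D" for c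
      using that T by (auto simp: extend_def tableaux_def less_Suc_eq)
    show "extend \<nu> T (i, j) \<le> extend \<nu> T (i, Suc j)" if "(i, j) \<in> ?D \<and> (i, Suc j) \<in> ?D" for i j
    proof (cases "(i, Suc j) \<in> rows_diagram N \<nu> m")
      case True
      then have "(i, j) \<in> rows_diagram N \<nu> m" using that by (auto simp: rows_diagram_def)
      then show ?thesis using True that T by (auto simp: extend_def tableaux_def)
    next
      case False
      then show ?thesis using that T by (auto simp: extend_def tableaux_def intro: less_imp_le)
    qed
    show "extend \<nu> T (i, j) < extend \<nu> T (Suc i, j)" if "(i, j) \<in> ?D \<and> (Suc i, j) \<in> ?D" for i j
    proof -
      have "i \<in> {1..N}" "j \<le> l (Suc i)" "m i < j" using that by (auto simp: rows_diagram_def)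
      moreover have "l (Suc i) \<le> \<nu> i" using \<nu> \<open>i \<in> {1..N}\<close> by (auto simp: PiE_iff)
      ultimately have "(i, j) \<in> rows_diagram N \<nu> m" by (auto simp: rows_diagram_def)
      then show ?thesis using that T by (auto simp: extend_def tableaux_def)
    qed
  qed
  have content: "image_mset (extend \<nu> T) (mset_set ?D)
      = replicate_mset (\<Sum>i\<in>{1..N}. l i - \<nu> i) p + image_mset T (mset_set (rows_diagram N \<nu> m))"
    if \<nu>: "\<nu> \<in> ?S" for \<nu> T
  proof -
    have D: "?D = rows_diagram N l \<nu> \<union> rows_diagram N \<nu> m"
    proof -
      have "{m i<..l i} = {\<nu> i<..l i} \<union> {m i<..\<nu> i}" if "i \<in> {1..N}" for i
        using bounds(2,3)[OF \<nu> that] by auto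
      then have "?D = (SIGMA i:{1..N}. {\<nu> i<..l i} \<union> {m i<..\<nu> i})"
        unfolding rows_diagram_def by (rule Sigma_cong[OF refl])
      then show ?thesis by (simp add: rows_diagram_def Sigma_Un_distrib2)
    qed
    have disj: "rows_diagram N l \<nu> \<inter> rows_diagram N \<nu> m = {}" by (auto simp: rows_diagram_def)
    have "image_mset (extend \<nu> T) (mset_set (rows_diagram N l \<nu>))
        = image_mset (\<lambda>_. p) (mset_set (rows_diagram N l \<nu>))"
      by (rule image_mset_cong) (use D disj in \<open>auto simp: extend_def\<close>)
    also have "\<dots> = replicate_mset (\<Sum>i\<in>{1..N}. l i - \<nu> i) p"
      by (simp add: image_mset_const_eq rows_diagram_def)
    finally have 1: "image_mset (extend \<nu> T) (mset_set (rows_diagram N l \<nu>))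
        = replicate_mset (\<Sum>i\<in>{1..N}. l i - \<nu> i) p" .
    have 2: "image_mset (extend \<nu> T) (mset_set (rows_diagram N \<nu> m))
        = image_mset T (mset_set (rows_diagram N \<nu> m))"
      by (rule image_mset_cong) (use D in \<open>auto simp: extend_def\<close>)
    have "mset_set ?D = mset_set (rows_diagram N l \<nu>) + mset_set (rows_diagram N \<nu> m)"
      unfolding D by (rule mset_set_Union) (use disj in auto)
    then show ?thesis by (simp add: 1 2)
  qed
  have "(\<Sum>\<nu>\<in>?S. monom (replicate_mset (\<Sum>i\<in>{1..N}. l i - \<nu> i) p) * tableau_sum p (rows_diagram N \<nu> m))
      = (\<Sum>\<nu>\<in>?S. \<Sum>T\<in>tableaux p (rows_diagram N \<nu> m). monom (image_mset (extend \<nu> T) (mset_set ?D)) :: 'a mps)"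
    unfolding tableau_sum_def sum_distrib_left monom_mult_monom
    by (intro sum.cong refl) (simp add: content)
  also have "\<dots> = (\<Sum>(\<nu>, T)\<in>(SIGMA \<nu>:?S. tableaux p (rows_diagram N \<nu> m)).
      monom (image_mset (extend \<nu> T) (mset_set ?D)))"
    by (rule sum.Sigma) (use finS in auto)
  also have "\<dots> = tableau_sum (Suc p) ?D"
    unfolding tableau_sum_def
  proof (rule sum.reindex_bij_witness[of _ "\<lambda>T. (shape T, restrict T (rows_diagram N (shape T) m))"
        "\<lambda>(\<nu>, T). extend \<nu> T"], goal_cases)
    case (1 x)
    then obtain \<nu> T where x: "x = (\<nu>, T)" "\<nu> \<in> ?S" "T \<in> tableaux p (rows_diagram N \<nu> m)" by auto
    have "shape (extend \<nu> T) i = \<nu> i" if i: "i \<in> {1..N}" for i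
    proof -
      have "{j \<in> {m i<..l i}. extend \<nu> T (i, j) < p} = {j. (i, j) \<in> {c \<in> ?D. extend \<nu> T c < p}}"
        using i by (auto simp: rows_diagram_def)
      also have "\<dots> = {m i<..\<nu> i}"
        unfolding extend_less[OF x(2,3)] using i by (auto simp: rows_diagram_def)
      finally show ?thesis using x(2) i by (simp add: shape_def)
    qed
    then have s: "shape (extend \<nu> T) = \<nu>"
      using x(2) by (auto simp: shape_def fun_eq_iff PiE_iff extensional_def)
    moreover have "restrict (extend \<nu> T) (rows_diagram N \<nu> m) = T"
    proof
      have ext: "T \<in> extensional (rows_diagram N \<nu> m)" using x(3) by (simp add: tableaux_def)
      show "restrict (extend \<nu> T) (rows_diagram N \<nu> m) c = T c" for c
        using sub[OF x(2)] extensional_arb[OF ext, of c]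
        by (cases "c \<in> rows_diagram N \<nu> m") (auto simp: extend_def)
    qed
    ultimately show ?case by (simp add: x(1))
  next
    case (2 x)
    then show ?case using extend_tableau by auto
  next
    case (3 T)
    have "extend (shape T) (restrict T (rows_diagram N (shape T) m)) c = T c" for c
    proof -
      have "T c = p" if "c \<in> ?D" "\<not> T c < p"
        using that 3 by (auto simp: tableaux_def less_Suc_eq)
      moreover have "T \<in> extensional ?D" using 3 by (simp add: tableaux_def)
      then have "T c = undefined" if "c \<notin> ?D" using that by (rule extensional_arb)
      ultimately show ?thesis by (auto simp: extend_def shape_diagram[OF 3])
    qed
    then show ?case by auto
  next
    case (4 T)
    have "restrict T (rows_diagram N (shape T) m) \<in> tableaux p (rows_diagram N (shape T) m)"
      using 4 unfolding shape_diagram[OF 4] by (auto simp: tableaux_def)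
    then show ?case using shape_S[OF 4] by auto
  qed auto
  finally show ?thesis by simp
qed

lemma tableau_sum_0: "tableau_sum 0 D = (if D = {} then 1 else 0)"
proof -
  have "tableaux 0 D = (if D = {} then {\<lambda>_. undefined} else {})"
    by (auto simp: tableaux_def)
  then show ?thesis by (simp add: tableau_sum_def)
qed

section \<open>The Jacobi-Trudi formula\<close>

text \<open>
  The complete homogeneous polynomial in the variables \<open>x\<^sub>0, \<dots>, x\<^sub>p\<^sub>-\<^sub>1\<close>.
\<close>
definition hpoly :: "nat \<Rightarrow> int \<Rightarrow> 'a::comm_ring_1 mps" where
  "hpoly p k = Abs_mps (\<lambda>m. if set_mset m \<subseteq> {..<p} \<and> int (size m) = k then 1 else 0)"

lemma mcoeff_hpoly:
  "mcoeff (hpoly p k) m = (if set_mset m \<subseteq> {..<p} \<and> int (size m) = k then 1 else 0)"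
  by (simp add: hpoly_def)

lemma hpoly_neg: "k < 0 \<Longrightarrow> hpoly p k = 0"
  by (rule mps_eqI) (auto simp: mcoeff_hpoly)

lemma hpoly_0: "hpoly 0 k = (if k = 0 then 1 else 0)"
  by (rule mps_eqI) (auto simp: mcoeff_hpoly one_mps_def)

text \<open>
  A monomial either avoids the last variable or is divisible by it.
\<close>
lemma hpoly_Suc: "hpoly (Suc p) k = hpoly p k + monom {#p#} * hpoly (Suc p) (k - 1)"
proof (rule mps_eqI)
  fix m
  show "mcoeff (hpoly (Suc p) k) m = mcoeff (hpoly p k + monom {#p#} * hpoly (Suc p) (k - 1)) m"
  proof (cases "p \<in># m")
    case True
    then obtain m' where "m = add_mset p m'" by (metis mset_add)
    then show ?thesis by (auto simp: plus_mps_def mcoeff_monom_mult mcoeff_hpoly)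
  next
    case False
    then have "set_mset m \<subseteq> {..<Suc p} \<longleftrightarrow> set_mset m \<subseteq> {..<p}"
      by (auto simp: less_Suc_eq subset_iff)
    then show ?thesis using False by (simp add: plus_mps_def mcoeff_monom_mult mcoeff_hpoly)
  qed
qed

text \<open>
  This is the previous recursion telescoped.  The summation range on the left is the range of one
  row length in the branching rule; on the right are two entries from neighbouring rows of the
  Jacobi-Trudi matrix with one more variable.
\<close>
lemma hpoly_Suc_interval:
  assumes "u \<le> w"
  shows "(\<Sum>k\<in>{u..w}. monom (replicate_mset (w - k) p) * hpoly p (int k + s))
       = (hpoly (Suc p) (int w + s) - monom (replicate_mset (Suc w - u) p) * hpoly (Suc p) (int u - 1 + s :: int) :: 'a::comm_ring_1 mps)"
  using assms
proof (induction w rule: dec_induct)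
  case base
  then show ?case using hpoly_Suc[of p "int u + s", where 'a = 'a] by (simp add: algebra_simps)
next
  case (step w)
  let ?x = "monom {#p#} :: 'a mps"
  have shift: "monom (replicate_mset (Suc k) p) = ?x * monom (replicate_mset k p)" for k
    by (simp add: monom_mult_monom)
  have "(\<Sum>k\<in>{u..Suc w}. monom (replicate_mset (Suc w - k) p) * hpoly p (int k + s) :: 'a mps)
      = (\<Sum>k\<in>{u..w}. monom (replicate_mset (Suc w - k) p) * hpoly p (int k + s)) + hpoly p (int (Suc w) + s)"
    using step.hyps by (simp add: atLeastAtMostSuc_conv add.commute)
  also have "(\<Sum>k\<in>{u..w}. monom (replicate_mset (Suc w - k) p) * hpoly p (int k + s) :: 'a mps)
      = ?x * (\<Sum>k\<in>{u..w}. monom (replicate_mset (w - k) p) * hpoly p (int k + s))"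
    unfolding sum_distrib_left
    by (rule sum.cong) (simp_all add: Suc_diff_le shift mult.assoc del: replicate_mset_Suc)
  also have "\<dots> = ?x * hpoly (Suc p) (int w + s)
      - monom (replicate_mset (Suc (Suc w) - u) p) * hpoly (Suc p) (int u - 1 + s)"
    using step.hyps
    by (simp add: step.IH right_diff_distrib Suc_diff_le shift mult.assoc del: replicate_mset_Suc)
  finally show ?case
    using hpoly_Suc[of p "int (Suc w) + s", where 'a = 'a] by (simp add: algebra_simps)
qed

lemma strict_mono_permutation_id:
  assumes "\<sigma> permutes {1..N::nat}" and mono: "\<And>i. i \<in> {1..<N} \<Longrightarrow> \<sigma> i < \<sigma> (Suc i)"
  shows "\<sigma> = id"
proof (rule permutes_natset_ge[OF assms(1)])
  have "i \<le> \<sigma> i" if "i \<in> {1..N}" for i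
    using that
  proof (induction i)
    case (Suc i)
    show ?case
    proof (cases "i = 0")
      case True
      then show ?thesis using permutes_in_image[OF assms(1), of 1] Suc.prems by auto
    next
      case False
      then show ?thesis using Suc mono[of i] by fastforce
    qed
  qed simp
  then show "\<forall>i\<in>{1..N}. i \<le> \<sigma> i" by blast
qed

text \<open>
  Without variables the matrix entry is \<open>1\<close> if \<open>l i - i = m j - j\<close> and \<open>0\<close> otherwise.  Both sequences are
  strictly decreasing, so a permutation with nonzero product must be increasing, hence the identity.
\<close>
lemma jacobi_trudi_0:
  assumes l: "\<And>i. i \<in> {1..<N} \<Longrightarrow> l (Suc i) \<le> l i"
    and m: "\<And>i. i \<in> {1..<N} \<Longrightarrow> m (Suc i) \<le> m i"
  shows "leibniz_det {1..N} (\<lambda>i j. hpoly 0 (int (l i) - int i - (int (m j) - int j)))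
       = (if \<forall>i\<in>{1..N}. l i = m i then 1 else (0 :: 'a::comm_ring_1 mps))"
proof -
  let ?E = "\<lambda>i j. hpoly 0 (int (l i) - int i - (int (m j) - int j)) :: 'a mps"
  have nonzero: "\<sigma> = id" "\<forall>i\<in>{1..N}. l i = m i"
    if \<sigma>: "\<sigma> permutes {1..N}" and nz: "(\<Prod>i\<in>{1..N}. ?E i (\<sigma> i)) \<noteq> 0" for \<sigma>
  proof -
    have "?E i (\<sigma> i) \<noteq> 0" if "i \<in> {1..N}" for i
      using nz prod_zero[of "{1..N}" "\<lambda>i. ?E i (\<sigma> i)"] that by blast
    then have eq: "int (l i) - int i = int (m (\<sigma> i)) - int (\<sigma> i)" if "i \<in> {1..N}" for i
      using that by (fastforce simp: hpoly_0 split: if_splits)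
    have m_le: "m y \<le> m x" if "x \<in> {1..N}" "x \<le> y" "y \<le> N" for x y
      using that(2,3)
    proof (induction y rule: dec_induct)
      case (step y)
      then show ?case using m[of y] that(1) by simp
    qed simp
    show "\<sigma> = id"
    proof (rule strict_mono_permutation_id[OF \<sigma>], rule ccontr)
      fix i assume i: "i \<in> {1..<N}" and "\<not> \<sigma> i < \<sigma> (Suc i)"
      then have "\<sigma> (Suc i) \<le> \<sigma> i" by simp
      moreover have "\<sigma> (Suc i) \<in> {1..N}" "\<sigma> i \<in> {1..N}"
        using i permutes_in_image[OF \<sigma>] by auto
      ultimately have "m (\<sigma> i) \<le> m (\<sigma> (Suc i))" using m_le by simp
      moreover have "int (l (Suc i)) - int (Suc i) < int (l i) - int i" using l[OF i] by simp
      ultimately show False using eq[of i] eq[of "Suc i"] i \<open>\<sigma> (Suc i) \<le> \<sigma> i\<close> by auto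
    qed
    then show "\<forall>i\<in>{1..N}. l i = m i" using eq by auto
  qed
  show ?thesis
  proof (cases "\<forall>i\<in>{1..N}. l i = m i")
    case True
    have "leibniz_det {1..N} ?E = (\<Sum>\<sigma> | \<sigma> permutes {1..N}. if \<sigma> = id then 1 else 0)"
      unfolding leibniz_det_def
    proof (rule sum.cong[OF refl])
      fix \<sigma> assume "\<sigma> \<in> {\<sigma>. \<sigma> permutes {1..N}}"
      then have "(\<Prod>i\<in>{1..N}. ?E i (\<sigma> i)) = 0" if "\<sigma> \<noteq> id" using nonzero(1) that by blast
      moreover have "(\<Prod>i\<in>{1..N}. ?E i (id i)) = 1" using True by (simp add: hpoly_0)
      ultimately show "of_int (sign \<sigma>) * (\<Prod>i\<in>{1..N}. ?E i (\<sigma> i)) = (if \<sigma> = id then 1 else 0)"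
        by auto
    qed
    also have "\<dots> = 1" by (subst sum.delta) (auto simp: finite_permutations)
    finally show ?thesis using True by simp
  next
    case False
    have "(\<Prod>i\<in>{1..N}. ?E i (\<sigma> i)) = 0" if "\<sigma> permutes {1..N}" for \<sigma>
      using nonzero(2)[OF that] False by blast
    then have "leibniz_det {1..N} ?E = 0" unfolding leibniz_det_def by (intro sum.neutral) simp
    then show ?thesis using False by simp
  qed
qed

text \<open>
  Induction on the number of variables.  From row \<open>i\<close> one subtracts
  \<open>x\<^sub>p ^ (l i - l (i + 1) + 1)\<close> times row \<open>i + 1\<close>.  This leaves the determinant unchanged and turns row \<open>i\<close>
  into a sum over \<open>l (i + 1) \<le> k \<le> l i\<close> of rows with one variable less.  Multilinear expansion then produces
  exactly the interlacing sequences \<open>\<nu>\<close> of the branching rule, without any cancellation.  The sequences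
  that do not contain \<open>m\<close> drop out by the induction hypothesis, which also covers the vanishing
  of the determinant.
\<close>
lemma jacobi_trudi:
  assumes l: "\<And>i. i \<in> {1..N} \<Longrightarrow> l (Suc i) \<le> l i" "l (Suc N) = 0"
    and m: "\<And>i. i \<in> {1..<N} \<Longrightarrow> m (Suc i) \<le> m i"
  shows "leibniz_det {1..N} (\<lambda>i j. hpoly p (int (l i) - int i - (int (m j) - int j)))
       = (if \<forall>i\<in>{1..N}. m i \<le> l i then tableau_sum p (rows_diagram N l m) else (0 :: 'a::comm_ring_1 mps))"
  using l
proof (induction p arbitrary: l)
  case 0
  have "(\<forall>i\<in>{1..N}. l i = m i) \<longleftrightarrow> (\<forall>i\<in>{1..N}. m i \<le> l i) \<and> rows_diagram N l m = {}"
    by (force simp: rows_diagram_def)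
  moreover have "l (Suc i) \<le> l i" if "i \<in> {1..<N}" for i using 0 that by simp
  ultimately show ?case
    using jacobi_trudi_0[of N l m, where 'a = 'a] m by (simp add: tableau_sum_0)
next
  case (Suc p)
  let ?x = "\<lambda>e. monom (replicate_mset e p) :: 'a mps"
  let ?B = "PiE {1..N} (\<lambda>i. {l (Suc i)..l i})"
  let ?fits = "\<lambda>\<nu>. \<forall>i\<in>{1..N}. m i \<le> \<nu> i"
  define f where "f i j = (if i = Suc N then 0
      else hpoly (Suc p) (int (l i) - int i - (int (m j) - int j)) :: 'a mps)" for i j
  define c where "c i = ?x (Suc (l i) - l (Suc i))" for i
  have row: "f i j - c i * f (Suc i) j
      = (\<Sum>k\<in>{l (Suc i)..l i}. ?x (l i - k) * hpoly p (int k - int i - (int (m j) - int j)))"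
    if i: "i \<in> {1..N}" and j: "j \<in> {1..N}" for i j
  proof -
    have "f (Suc i) j = hpoly (Suc p) (int (l (Suc i)) - 1 + (- int i - (int (m j) - int j)))"
    proof (cases "i = N")
      case True
      then show ?thesis using Suc.prems(2) j by (simp add: f_def hpoly_neg)
    qed (use i in \<open>simp add: f_def algebra_simps\<close>)
    moreover have "f i j = hpoly (Suc p) (int (l i) + (- int i - (int (m j) - int j)))"
      using i by (simp add: f_def algebra_simps)
    moreover have "int k - int i - (int (m j) - int j) = int k + (- int i - (int (m j) - int j))" for k
      by simp
    ultimately show ?thesis
      using hpoly_Suc_interval[OF Suc.prems(1)[OF i], of p "- int i - (int (m j) - int j)", where 'a = 'a]
      by (simp only: c_def)
  qed
  have "leibniz_det {1..N} (\<lambda>i j. hpoly (Suc p) (int (l i) - int i - (int (m j) - int j)) :: 'a mps)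
      = leibniz_det {1..N} f"
    by (rule leibniz_det_cong) (auto simp: f_def)
  also have "\<dots> = leibniz_det {1..N} (\<lambda>i j. f i j - c i * f (Suc i) j)"
    by (rule leibniz_det_subtract_next_rows[symmetric]) (simp add: f_def)
  also have "\<dots> = leibniz_det {1..N} (\<lambda>i j. \<Sum>k\<in>{l (Suc i)..l i}.
      ?x (l i - k) * hpoly p (int k - int i - (int (m j) - int j)))"
    by (rule leibniz_det_cong) (rule row)
  also have "\<dots> = (\<Sum>\<nu>\<in>?B. (\<Prod>i\<in>{1..N}. ?x (l i - \<nu> i)) *
      leibniz_det {1..N} (\<lambda>i j. hpoly p (int (\<nu> i) - int i - (int (m j) - int j))))"
    by (rule leibniz_det_row_sums) auto
  also have "\<dots> = (\<Sum>\<nu>\<in>?B. if ?fits \<nu> then ?x (\<Sum>i\<in>{1..N}. l i - \<nu> i) * tableau_sum p (rows_diagram N \<nu> m) else 0)"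
  proof (rule sum.cong[OF refl])
    fix \<nu> assume \<nu>: "\<nu> \<in> ?B"
    \<comment> \<open>Elements of an extensional product are unspecified at \<open>Suc N\<close>, where the hypothesis asks for \<open>0\<close>.\<close>
    define \<nu>' where "\<nu>' = \<nu>(Suc N := 0)"
    have decreasing: "\<nu>' (Suc i) \<le> \<nu>' i" if "i \<in> {1..N}" for i
    proof (cases "i = N")
      case False
      then have "\<nu> (Suc i) \<le> l (Suc i)" "l (Suc i) \<le> \<nu> i" using \<nu> that by (auto simp: PiE_iff)
      then show ?thesis using False that by (simp add: \<nu>'_def)
    qed (simp add: \<nu>'_def)
    have "leibniz_det {1..N} (\<lambda>i j. hpoly p (int (\<nu> i) - int i - (int (m j) - int j)))
        = leibniz_det {1..N} (\<lambda>i j. hpoly p (int (\<nu>' i) - int i - (int (m j) - int j)) :: 'a mps)"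
      by (rule leibniz_det_cong) (auto simp: \<nu>'_def)
    also have "\<dots> = (if ?fits \<nu>' then tableau_sum p (rows_diagram N \<nu>' m) else 0)"
    proof (rule Suc.IH)
      show "\<nu>' (Suc N) = 0" by (simp add: \<nu>'_def)
    qed (rule decreasing)
    also have "rows_diagram N \<nu>' m = rows_diagram N \<nu> m"
      by (auto simp: rows_diagram_def \<nu>'_def)
    also have "?fits \<nu>' \<longleftrightarrow> ?fits \<nu>" by (auto simp: \<nu>'_def)
    finally have det: "leibniz_det {1..N} (\<lambda>i j. hpoly p (int (\<nu> i) - int i - (int (m j) - int j)))
        = (if ?fits \<nu> then tableau_sum p (rows_diagram N \<nu> m) else (0 :: 'a mps))" .
    show "(\<Prod>i\<in>{1..N}. ?x (l i - \<nu> i)) *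
        leibniz_det {1..N} (\<lambda>i j. hpoly p (int (\<nu> i) - int i - (int (m j) - int j)))
      = (if ?fits \<nu> then ?x (\<Sum>i\<in>{1..N}. l i - \<nu> i) * tableau_sum p (rows_diagram N \<nu> m) else 0)"
      unfolding det by (simp add: prod_monom_replicate)
  qed
  also have "\<dots> = (\<Sum>\<nu> | \<nu> \<in> ?B \<and> ?fits \<nu>.
      ?x (\<Sum>i\<in>{1..N}. l i - \<nu> i) * tableau_sum p (rows_diagram N \<nu> m))"
    by (rule sum.inter_filter[symmetric]) (auto intro!: finite_PiE)
  also have "\<dots> = (if ?fits l then tableau_sum (Suc p) (rows_diagram N l m) else 0)"
  proof (cases "?fits l")
    case True
    then show ?thesis using tableau_sum_branching[of N l m p, where 'a = 'a] Suc.prems m by simp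
  next
    case False
    have "{\<nu>. \<nu> \<in> ?B \<and> ?fits \<nu>} = {}"
    proof (rule ccontr)
      assume "{\<nu>. \<nu> \<in> ?B \<and> ?fits \<nu>} \<noteq> {}"
      then obtain \<nu> where "\<nu> \<in> ?B" "?fits \<nu>" by blast
      then have "?fits l" by (fastforce simp: PiE_iff intro: order_trans)
      then show False using False by blast
    qed
    then show ?thesis using False by (simp only: sum.empty if_False)
  qed
  finally show ?case .
qed

section \<open>The Pfaffian as a sum of determinants\<close>

text \<open>
  The factors are treated one after the other.  Composing \<open>\<sigma>\<close> with the transposition of \<open>2 * j - 1\<close> and
  \<open>2 * j\<close> exchanges the two summands of factor \<open>j\<close>, fixes all other factors and changes the sign;
  so both summands contribute equally.
\<close>
lemma signed_sum_antisymmetrized: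
  fixes A :: "nat \<Rightarrow> nat \<Rightarrow> 'a::comm_ring_1"
  shows "(\<Sum>\<sigma> | \<sigma> permutes {1..2 * n}. of_int (sign \<sigma>) *
            (\<Prod>i\<in>{1..n}. A (\<sigma> (2 * i - 1)) (\<sigma> (2 * i)) - A (\<sigma> (2 * i)) (\<sigma> (2 * i - 1))))
       = 2 ^ n * (\<Sum>\<sigma> | \<sigma> permutes {1..2 * n}. of_int (sign \<sigma>) *
            (\<Prod>i\<in>{1..n}. A (\<sigma> (2 * i - 1)) (\<sigma> (2 * i))))"
proof -
  define B where "B i \<sigma> = A (\<sigma> (2 * i - 1)) (\<sigma> (2 * i))" for i and \<sigma> :: "nat \<Rightarrow> nat"
  define C where "C i \<sigma> = A (\<sigma> (2 * i)) (\<sigma> (2 * i - 1))" for i and \<sigma> :: "nat \<Rightarrow> nat"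
  let ?S = "\<lambda>F. \<Sum>\<sigma> | \<sigma> permutes {1..2 * n}. of_int (sign \<sigma>) * (F \<sigma> :: 'a)"
  \<comment> \<open>\<open>J\<close> is the set of factors that are still antisymmetrized.\<close>
  have "?S (\<lambda>\<sigma>. (\<Prod>i\<in>J. B i \<sigma> - C i \<sigma>) * (\<Prod>i\<in>{1..n} - J. B i \<sigma>))
      = 2 ^ card J * ?S (\<lambda>\<sigma>. \<Prod>i\<in>{1..n}. B i \<sigma>)" if "J \<subseteq> {1..n}" for J
    using finite_subset[OF that finite_atLeastAtMost] that
  proof (induction J rule: finite_induct)
    case (insert j J)
    then have j: "j \<in> {1..n}" and J: "J \<subseteq> {1..n}" by auto
    define X where "X \<sigma> = (\<Prod>i\<in>J. B i \<sigma> - C i \<sigma>) * (\<Prod>i\<in>{1..n} - insert j J. B i \<sigma>)" for \<sigma>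
    let ?t = "transpose (2 * j - 1) (2 * j)"
    have other: "B i (\<sigma> \<circ> ?t) = B i \<sigma>" "C i (\<sigma> \<circ> ?t) = C i \<sigma>" if "i \<in> {1..n}" "i \<noteq> j" for i \<sigma>
    proof -
      have "?t (2 * i) = 2 * i" "?t (2 * i - 1) = 2 * i - 1"
        using that j by (auto simp: transpose_def)
      then show "B i (\<sigma> \<circ> ?t) = B i \<sigma>" "C i (\<sigma> \<circ> ?t) = C i \<sigma>" by (simp_all add: B_def C_def)
    qed
    have X: "X (\<sigma> \<circ> ?t) = X \<sigma>" for \<sigma>
    proof -
      have "(\<Prod>i\<in>J. B i (\<sigma> \<circ> ?t) - C i (\<sigma> \<circ> ?t)) = (\<Prod>i\<in>J. B i \<sigma> - C i \<sigma>)"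
      proof (rule prod.cong[OF refl])
        fix i assume "i \<in> J"
        then have i: "i \<in> {1..n}" "i \<noteq> j" using insert.hyps J by auto
        show "B i (\<sigma> \<circ> ?t) - C i (\<sigma> \<circ> ?t) = B i \<sigma> - C i \<sigma>" by (simp only: other[OF i])
      qed
      moreover have "(\<Prod>i\<in>{1..n} - insert j J. B i (\<sigma> \<circ> ?t)) = (\<Prod>i\<in>{1..n} - insert j J. B i \<sigma>)"
        by (rule prod.cong[OF refl]) (rule other, auto)
      ultimately show ?thesis by (simp only: X_def)
    qed
    have C: "C j \<sigma> = B j (\<sigma> \<circ> ?t)" for \<sigma>
      by (simp add: B_def C_def)
    have "?S (\<lambda>\<sigma>. (\<Prod>i\<in>insert j J. B i \<sigma> - C i \<sigma>) * (\<Prod>i\<in>{1..n} - insert j J. B i \<sigma>))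
        = ?S (\<lambda>\<sigma>. X \<sigma> * B j \<sigma>) - ?S (\<lambda>\<sigma>. X (\<sigma> \<circ> ?t) * B j (\<sigma> \<circ> ?t))"
      unfolding sum_subtractf[symmetric] X C[symmetric] unfolding X_def
      by (rule sum.cong[OF refl]) (use insert.hyps in \<open>simp add: algebra_simps\<close>)
    also have "?S (\<lambda>\<sigma>. X (\<sigma> \<circ> ?t) * B j (\<sigma> \<circ> ?t)) = - ?S (\<lambda>\<sigma>. X \<sigma> * B j \<sigma>)"
      by (rule signed_sum_transpose[where F = "\<lambda>\<sigma>. X \<sigma> * B j \<sigma>"]) (use j in auto)
    also have "?S (\<lambda>\<sigma>. X \<sigma> * B j \<sigma>) - - ?S (\<lambda>\<sigma>. X \<sigma> * B j \<sigma>) = 2 * ?S (\<lambda>\<sigma>. X \<sigma> * B j \<sigma>)"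
      by simp
    also have "?S (\<lambda>\<sigma>. X \<sigma> * B j \<sigma>)
        = ?S (\<lambda>\<sigma>. (\<Prod>i\<in>J. B i \<sigma> - C i \<sigma>) * (\<Prod>i\<in>{1..n} - J. B i \<sigma>))"
    proof -
      have "(\<Prod>i\<in>{1..n} - J. B i \<sigma>) = B j \<sigma> * (\<Prod>i\<in>{1..n} - J - {j}. B i \<sigma>)" for \<sigma>
        by (rule prod.remove) (use j insert.hyps in auto)
      then show ?thesis
        by (simp only: X_def Diff_insert[symmetric] mult_ac)
    qed
    also have "2 * \<dots> = 2 ^ card (insert j J) * ?S (\<lambda>\<sigma>. \<Prod>i\<in>{1..n}. B i \<sigma>)"
      by (simp only: insert.IH[OF J] card_insert_disjoint[OF insert.hyps] power_Suc mult.assoc)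
    finally show ?case .
  qed simp
  from this[OF subset_refl] show ?thesis
    by (simp only: Diff_cancel prod.empty mult_1_right card_atLeastAtMost diff_Suc_1 B_def C_def)
qed

lemma prod_pairs:
  fixes n :: nat
  shows "(\<Prod>i\<in>{1..n}. g (2 * i - 1) * g (2 * i)) = (\<Prod>q\<in>{1..2 * n}. g q :: 'a::comm_monoid_mult)"
proof (induction n)
  case (Suc n)
  have "{1..2 * Suc n} = insert (2 * Suc n) (insert (2 * Suc n - 1) {1..2 * n})" by auto
  then show ?case using Suc by (simp add: atLeastAtMostSuc_conv mult_ac)
qed simp

text \<open>
  The column sequence \<open>\<kappa> 1, \<kappa> 1 + 1, \<kappa> 2, \<kappa> 2 + 1, \<dots>\<close> selected by a choice of the nonzero entries
  \<open>(\<kappa> i, \<kappa> i + 1)\<close> of the band matrix.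
\<close>
definition pair_columns :: "(nat \<Rightarrow> nat) \<Rightarrow> nat \<Rightarrow> nat" where
  "pair_columns \<kappa> q = \<kappa> ((q + 1) div 2) + (if even q then 1 else 0)"

text \<open>
  The odd position is written with \<open>Suc 0\<close>, the normal form of the simplifier.
\<close>
lemma pair_columns_odd: "i \<ge> 1 \<Longrightarrow> pair_columns \<kappa> (2 * i - Suc 0) = \<kappa> i"
  by (cases i) (auto simp: pair_columns_def)

lemma pair_columns_even: "pair_columns \<kappa> (2 * i) = Suc (\<kappa> i)"
  by (simp add: pair_columns_def)

abbreviation pair_minor :: "nat \<Rightarrow> (nat \<Rightarrow> nat \<Rightarrow> 'a::comm_ring_1) \<Rightarrow> (nat \<Rightarrow> nat) \<Rightarrow> 'a" where
  "pair_minor n H \<kappa> \<equiv> leibniz_det {1..2 * n} (\<lambda>q r. H r (pair_columns \<kappa> q))"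

lemma signed_sum_pair_minors:
  fixes H :: "nat \<Rightarrow> nat \<Rightarrow> 'a::comm_ring_1"
  assumes "finite J"
  shows "(\<Sum>\<sigma> | \<sigma> permutes {1..2 * n}. of_int (sign \<sigma>) *
            (\<Prod>i\<in>{1..n}. \<Sum>k\<in>J. v k * (H (\<sigma> (2 * i - 1)) k * H (\<sigma> (2 * i)) (Suc k))))
       = (\<Sum>\<kappa>\<in>{1..n} \<rightarrow>\<^sub>E J. (\<Prod>i\<in>{1..n}. v (\<kappa> i)) * pair_minor n H \<kappa>)"
proof -
  have pairs: "(\<Prod>i\<in>{1..n}. H (\<sigma> (2 * i - 1)) (\<kappa> i) * H (\<sigma> (2 * i)) (Suc (\<kappa> i)))
      = (\<Prod>q\<in>{1..2 * n}. H (\<sigma> q) (pair_columns \<kappa> q))" for \<sigma> \<kappa>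
    unfolding prod_pairs[symmetric]
    by (rule prod.cong) (auto simp: pair_columns_odd pair_columns_even)
  have expand: "(\<Prod>i\<in>{1..n}. \<Sum>k\<in>J. v k * (H (\<sigma> (2 * i - 1)) k * H (\<sigma> (2 * i)) (Suc k)))
      = (\<Sum>\<kappa>\<in>{1..n} \<rightarrow>\<^sub>E J. (\<Prod>i\<in>{1..n}. v (\<kappa> i)) * (\<Prod>q\<in>{1..2 * n}. H (\<sigma> q) (pair_columns \<kappa> q)))" for \<sigma>
    unfolding pairs[symmetric] prod.distrib[symmetric]
    by (rule prod_sum_PiE) (use assms in auto)
  show ?thesis
    unfolding leibniz_det_def expand sum_distrib_left
    by (subst sum.swap) (rule sum.cong[OF refl], rule sum.cong[OF refl], rule mult.left_commute)
qed

lemma pair_minor_cong: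
  assumes "\<And>i. i \<in> {1..n} \<Longrightarrow> \<kappa> i = \<kappa>' i"
  shows "pair_minor n H \<kappa> = pair_minor n H \<kappa>'"
proof (rule leibniz_det_cong)
  fix q assume "q \<in> {1..2 * n}"
  then have "(q + 1) div 2 \<in> {1..n}" by auto
  then show "H r (pair_columns \<kappa> q) = H r (pair_columns \<kappa>' q)" for r
    unfolding pair_columns_def by (simp only: assms)
qed

lemma pair_minor_eq_0:
  assumes "i \<in> {1..n}" "j \<in> {1..n}" "i \<noteq> j" "\<kappa> i = \<kappa> j \<or> \<kappa> i = Suc (\<kappa> j)"
  shows "pair_minor n H \<kappa> = 0"
  using assms(4)
proof
  assume "\<kappa> i = \<kappa> j"
  then show ?thesis
    using assms(1-3) pair_columns_even[of \<kappa>]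
    by (intro leibniz_det_equal_rows[of _ "2 * i" "2 * j"]) auto
next
  assume "\<kappa> i = Suc (\<kappa> j)"
  then have "pair_columns \<kappa> (2 * i - 1) = pair_columns \<kappa> (2 * j)"
    using assms(1) by (simp add: pair_columns_odd pair_columns_even)
  moreover have "2 * i - 1 \<noteq> 2 * j" using assms(1) by auto presburger
  ultimately show ?thesis
    using assms(1-3) by (intro leibniz_det_equal_rows[of _ "2 * i - 1" "2 * j"]) auto
qed

text \<open>
  Exchanging two pairs of adjacent columns is a product of two transpositions, so no sign appears.
\<close>
lemma pair_minor_permute:
  assumes "\<pi> permutes {1..n}"
  shows "pair_minor n H (\<kappa> \<circ> \<pi>) = pair_minor n H \<kappa>"
proof -
  have "\<forall>\<kappa>. pair_minor n H (\<kappa> \<circ> \<pi>) = pair_minor n H \<kappa>"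
    using assms finite_atLeastAtMost
  proof (induction \<pi> rule: permutes_induct)
    case (swap a b p)
    show ?case
    proof
      fix \<kappa>
      let ?s = "transpose (2 * a - 1) (2 * b - 1)" and ?t = "transpose (2 * a) (2 * b)"
      have ab: "1 \<le> a" "1 \<le> b" "a \<noteq> b" using swap by auto
      have cols: "pair_columns (\<kappa> \<circ> transpose a b) q = pair_columns \<kappa> (?s (?t q))"
        if q: "q \<in> {1..2 * n}" for q
      proof (cases "even q")
        case True
        then obtain i where i: "q = 2 * i" by blast
        have "?t (2 * i) = 2 * transpose a b i" by (auto simp: transpose_def)
        moreover have "?s (2 * x) = 2 * x" for x
          using ab by (auto simp: transpose_def) presburger+
        ultimately show ?thesis by (simp add: i pair_columns_even)
      next
        case False
        define i where "i = (q + 1) div 2"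
        have i: "q = 2 * i - 1" "1 \<le> i" using False q by (auto simp: i_def elim!: oddE)
        have "?t (2 * i - 1) = 2 * i - 1"
          using i(2) ab by (auto simp: transpose_def) presburger+
        moreover have "?s (2 * i - 1) = 2 * transpose a b i - 1"
          using i(2) ab by (auto simp: transpose_def)
        moreover have "1 \<le> transpose a b i" using i(2) ab by (auto simp: transpose_def)
        ultimately show ?thesis using i(2) by (simp add: i(1) pair_columns_odd)
      qed
      have "pair_minor n H (\<kappa> \<circ> (transpose a b \<circ> p)) = pair_minor n H (\<kappa> \<circ> transpose a b)"
        unfolding comp_assoc[symmetric] using swap.IH by blast
      also have "\<dots> = leibniz_det {1..2 * n} (\<lambda>q r. H r (pair_columns \<kappa> (?s (?t q))))"
        by (rule leibniz_det_cong) (simp only: cols)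
      also have "\<dots> = - leibniz_det {1..2 * n} (\<lambda>q r. H r (pair_columns \<kappa> (?s q)))"
        by (rule leibniz_det_swap_rows) (use swap in auto)
      also have "leibniz_det {1..2 * n} (\<lambda>q r. H r (pair_columns \<kappa> (?s q))) = - pair_minor n H \<kappa>"
        by (rule leibniz_det_swap_rows) (use swap in auto)
      finally show "pair_minor n H (\<kappa> \<circ> (transpose a b \<circ> p)) = pair_minor n H \<kappa>"
        by (simp only: minus_minus)
    qed
  qed simp
  then show ?thesis by blast
qed

definition enum_set :: "nat set \<Rightarrow> nat \<Rightarrow> nat" where
  "enum_set A i = sorted_list_of_set A ! (i - 1)"

lemma bij_betw_enum_set:
  assumes "finite A"
  shows "bij_betw (enum_set A) {1..card A} A"
proof -
  have "bij_betw ((!) (sorted_list_of_set A)) {..<card A} A"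
    by (rule bij_betw_nth) (use assms in auto)
  moreover have "bij_betw (\<lambda>i. i - 1) {1..card A} {..<card A}"
    by (rule bij_betw_byWitness[where f' = Suc]) auto
  ultimately show ?thesis
    unfolding enum_set_def using bij_betw_trans[of "\<lambda>i. i - 1" "{1..card A}"] by (fastforce simp: comp_def)
qed

text \<open>
  An injective \<open>\<kappa>\<close> with image \<open>A\<close> is the increasing enumeration of \<open>A\<close> composed with a unique permutation
  of \<open>{1..n}\<close>, which accounts for the factor \<open>n!\<close>.
\<close>
lemma sum_symmetric_functions:
  fixes F :: "(nat \<Rightarrow> nat) \<Rightarrow> 'a::comm_ring_1"
  assumes J: "finite J"
    and cong: "\<And>\<kappa> \<kappa>'. (\<And>i. i \<in> {1..n} \<Longrightarrow> \<kappa> i = \<kappa>' i) \<Longrightarrow> F \<kappa> = F \<kappa>'"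
    and perm: "\<And>\<kappa> \<pi>. \<pi> permutes {1..n} \<Longrightarrow> F (\<kappa> \<circ> \<pi>) = F \<kappa>"
    and inj: "\<And>\<kappa>. \<not> inj_on \<kappa> {1..n} \<Longrightarrow> F \<kappa> = 0"
  shows "(\<Sum>\<kappa>\<in>{1..n} \<rightarrow>\<^sub>E J. F \<kappa>) = of_nat (fact n) * (\<Sum>A | A \<subseteq> J \<and> card A = n. F (enum_set A))"
proof -
  let ?I = "{\<kappa> \<in> {1..n} \<rightarrow>\<^sub>E J. inj_on \<kappa> {1..n}}"
  have fin: "finite ({1..n} \<rightarrow>\<^sub>E J)" using J by (intro finite_PiE) auto
  have finI: "finite ?I" using fin by (rule finite_subset[rotated]) auto
  have "(\<Sum>\<kappa>\<in>{1..n} \<rightarrow>\<^sub>E J. F \<kappa>) = (\<Sum>\<kappa>\<in>?I. F \<kappa>)"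
    by (rule sum.mono_neutral_right) (use fin inj in auto)
  also have "\<dots> = (\<Sum>A | A \<subseteq> J \<and> card A = n. \<Sum>\<kappa> | \<kappa> \<in> ?I \<and> \<kappa> ` {1..n} = A. F \<kappa>)"
    by (rule sum.group[OF finI, symmetric]) (use J in \<open>auto simp: card_image PiE_iff\<close>)
  also have "\<dots> = (\<Sum>A | A \<subseteq> J \<and> card A = n. of_nat (fact n) * F (enum_set A))"
  proof (rule sum.cong[OF refl])
    fix A assume "A \<in> {A. A \<subseteq> J \<and> card A = n}"
    then have A: "A \<subseteq> J" "card A = n" "finite A" using J finite_subset by auto
    let ?e = "enum_set A"
    have e: "bij_betw ?e {1..n} A" using bij_betw_enum_set[OF A(3)] A(2) by simp
    have img: "{\<kappa>. \<kappa> \<in> ?I \<and> \<kappa> ` {1..n} = A}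
        = (\<lambda>\<pi>. restrict (?e \<circ> \<pi>) {1..n}) ` {\<pi>. \<pi> permutes {1..n}}"
    proof (intro equalityI subsetI)
      fix \<kappa> assume "\<kappa> \<in> {\<kappa>. \<kappa> \<in> ?I \<and> \<kappa> ` {1..n} = A}"
      then have \<kappa>: "\<kappa> \<in> extensional {1..n}" "bij_betw \<kappa> {1..n} A"
        by (auto simp: PiE_def bij_betw_def)
      define \<pi> where "\<pi> i = (if i \<in> {1..n} then inv_into {1..n} ?e (\<kappa> i) else i)" for i
      have "bij_betw (inv_into {1..n} ?e \<circ> \<kappa>) {1..n} {1..n}"
        using \<kappa>(2) bij_betw_inv_into[OF e] by (rule bij_betw_trans)
      then have "bij_betw \<pi> {1..n} {1..n}"
        by (subst bij_betw_cong[of _ _ "inv_into {1..n} ?e \<circ> \<kappa>"]) (auto simp: \<pi>_def)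
      then have "\<pi> permutes {1..n}" by (rule bij_imp_permutes) (auto simp: \<pi>_def)
      moreover have "?e (\<pi> i) = \<kappa> i" if "i \<in> {1..n}" for i
        using that \<kappa>(2) e by (simp add: \<pi>_def bij_betw_inv_into_right bij_betwE)
      then have "\<kappa> = restrict (?e \<circ> \<pi>) {1..n}"
        using \<kappa>(1) by (intro extensionalityI[where A = "{1..n}"]) auto
      ultimately show "\<kappa> \<in> (\<lambda>\<pi>. restrict (?e \<circ> \<pi>) {1..n}) ` {\<pi>. \<pi> permutes {1..n}}" by blast
    next
      fix \<kappa> assume "\<kappa> \<in> (\<lambda>\<pi>. restrict (?e \<circ> \<pi>) {1..n}) ` {\<pi>. \<pi> permutes {1..n}}"
      then obtain \<pi> where \<pi>: "\<pi> permutes {1..n}" "\<kappa> = restrict (?e \<circ> \<pi>) {1..n}" by blast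
      have "bij_betw (?e \<circ> \<pi>) {1..n} A"
        using permutes_imp_bij[OF \<pi>(1)] e by (rule bij_betw_trans)
      then have "bij_betw \<kappa> {1..n} A"
        by (subst bij_betw_cong[of _ _ "?e \<circ> \<pi>"]) (auto simp: \<pi>(2))
      moreover have "\<kappa> \<in> extensional {1..n}" by (simp add: \<pi>(2))
      ultimately show "\<kappa> \<in> {\<kappa>. \<kappa> \<in> ?I \<and> \<kappa> ` {1..n} = A}"
        using A(1) by (auto simp: PiE_def bij_betw_def)
    qed
    have "inj_on (\<lambda>\<pi>. restrict (?e \<circ> \<pi>) {1..n}) {\<pi>. \<pi> permutes {1..n}}"
    proof (rule inj_onI)
      fix \<pi> \<pi>' assume p: "\<pi> \<in> {\<pi>. \<pi> permutes {1..n}}" "\<pi>' \<in> {\<pi>. \<pi> permutes {1..n}}"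
        and eq: "restrict (?e \<circ> \<pi>) {1..n} = restrict (?e \<circ> \<pi>') {1..n}"
      have "\<pi> i = \<pi>' i" for i
      proof (cases "i \<in> {1..n}")
        case True
        have "?e (\<pi> i) = ?e (\<pi>' i)" using fun_cong[OF eq, of i] True by simp
        moreover have "\<pi> i \<in> {1..n}" "\<pi>' i \<in> {1..n}"
          using p True permutes_in_image by (metis mem_Collect_eq)+
        ultimately show ?thesis using e by (meson bij_betw_imp_inj_on inj_onD)
      next
        case False
        then show ?thesis using p permutes_not_in by (metis mem_Collect_eq)
      qed
      then show "\<pi> = \<pi>'" by blast
    qed
    then have "(\<Sum>\<kappa> | \<kappa> \<in> ?I \<and> \<kappa> ` {1..n} = A. F \<kappa>)
        = (\<Sum>\<pi> | \<pi> permutes {1..n}. F (restrict (?e \<circ> \<pi>) {1..n}))"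
      unfolding img by (simp add: sum.reindex)
    also have "\<dots> = (\<Sum>\<pi> | \<pi> permutes {1..n}. F ?e)"
    proof (rule sum.cong[OF refl])
      fix \<pi> assume "\<pi> \<in> {\<pi>. \<pi> permutes {1..n}}"
      then show "F (restrict (?e \<circ> \<pi>) {1..n}) = F ?e"
        using cong[of "restrict (?e \<circ> \<pi>) {1..n}" "?e \<circ> \<pi>"] perm[of \<pi> ?e] by simp
    qed
    also have "\<dots> = of_nat (fact n) * F ?e"
    proof -
      have "card {\<pi>. \<pi> permutes {1..n}} = fact n" by (rule card_permutations) auto
      then show ?thesis by (simp only: sum_constant)
    qed
    finally show "(\<Sum>\<kappa> | \<kappa> \<in> ?I \<and> \<kappa> ` {1..n} = A. F \<kappa>) = of_nat (fact n) * F ?e" .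
  qed
  finally show ?thesis by (simp add: sum_distrib_left)
qed

text \<open>
  The index of the variable \<open>v\<close> that belongs to the \<open>i\<close>-th entry of the tuple \<open>a\<close>.  Weakly increasing
  tuples are thereby turned into increasing sequences with all gaps at least \<open>2\<close>.
\<close>
definition spread :: "nat list \<Rightarrow> nat \<Rightarrow> nat" where
  "spread a i = a ! (i - 1) + 2 * i - 1"

lemma spread_strict_mono:
  assumes "sorted a" "i \<in> {1..length a}" "j \<in> {1..length a}" "i < j"
  shows "spread a i < spread a j"
proof -
  have "a ! (i - 1) \<le> a ! (j - 1)" using assms by (intro sorted_nth_mono) auto
  then show ?thesis using assms by (simp add: spread_def)
qed

lemma enum_set_spread:
  assumes "sorted a" "i \<in> {1..length a}"
  shows "enum_set (spread a ` {1..length a}) i = spread a i"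
proof -
  let ?w = "map (\<lambda>i. spread a (Suc i)) [0..<length a]"
  have "sorted_wrt (<) ?w"
    unfolding sorted_wrt_iff_nth_less using assms(1) by (auto intro!: spread_strict_mono)
  then have "sorted_list_of_set (set ?w) = ?w"
    by (intro sorted_list_of_set.idem_if_sorted_distinct) (auto simp: strict_sorted_iff)
  moreover have "set ?w = spread a ` {1..length a}"
    by (simp add: image_image[symmetric] image_Suc_atLeastLessThan atLeastLessThanSuc_atLeastAtMost flip: image_image[of "spread a" Suc])
  ultimately show ?thesis using assms(2) by (cases i) (auto simp: enum_set_def)
qed

text \<open>
  A set with two adjacent elements contributes nothing.  The others are those whose increasing
  enumeration has all gaps at least \<open>2\<close>, and these are the sequences \<open>spread a\<close>.
\<close>
lemma sum_subsets_without_adjacent: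
  fixes F :: "(nat \<Rightarrow> nat) \<Rightarrow> 'a::comm_ring_1"
  assumes cong: "\<And>\<kappa> \<kappa>'. (\<And>i. i \<in> {1..n} \<Longrightarrow> \<kappa> i = \<kappa>' i) \<Longrightarrow> F \<kappa> = F \<kappa>'"
    and adj: "\<And>\<kappa> i. i \<in> {1..<n} \<Longrightarrow> \<kappa> (Suc i) = Suc (\<kappa> i) \<Longrightarrow> F \<kappa> = 0"
  shows "(\<Sum>A | A \<subseteq> {1..<K} \<and> card A = n. F (enum_set A))
       = (\<Sum>a | length a = n \<and> sorted a \<and> spread a ` {1..n} \<subseteq> {1..<K}. F (spread a))"
proof -
  let ?L = "{a. length a = n \<and> sorted a \<and> spread a ` {1..n} \<subseteq> {1..<K}}"
  let ?P = "{A. A \<subseteq> {1..<K} \<and> card A = n}"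
  let ?im = "\<lambda>a. spread a ` {1..n}"
  have "inj_on ?im ?L"
  proof (rule inj_onI)
    fix a b assume ab: "a \<in> ?L" "b \<in> ?L" "?im a = ?im b"
    have "spread a i = spread b i" if "i \<in> {1..n}" for i
      using enum_set_spread[of a i] enum_set_spread[of b i] ab that by simp
    from this[of "Suc _"] have "a ! i = b ! i" if "i < n" for i
      using that by (simp add: spread_def)
    then show "a = b" using ab by (intro nth_equalityI) auto
  qed
  then have "(\<Sum>a\<in>?L. F (spread a)) = (\<Sum>A\<in>?im ` ?L. F (enum_set A))"
    by (simp add: sum.reindex) (rule sum.cong[OF refl], rule cong, use enum_set_spread in auto)
  also have "\<dots> = (\<Sum>A\<in>?P. F (enum_set A))"
  proof (rule sum.mono_neutral_left)
    show "finite ?P" by simp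
    have "inj_on (spread a) {1..n}" if "a \<in> ?L" for a
      using that spread_strict_mono[of a] by (intro linorder_inj_onI) (auto simp: less_imp_neq)
    then show "?im ` ?L \<subseteq> ?P" by (auto simp: card_image)
    show "\<forall>A\<in>?P - ?im ` ?L. F (enum_set A) = 0"
    proof (rule ballI, rule ccontr)
      fix A assume A: "A \<in> ?P - ?im ` ?L" and nz: "F (enum_set A) \<noteq> 0"
      let ?e = "enum_set A"
      have finA: "finite A" using A finite_subset[of A "{1..<K}"] by auto
      have bij: "bij_betw ?e {1..n} A" using bij_betw_enum_set[OF finA] A by simp
      have lt: "?e i < ?e (Suc i)" if "i \<in> {1..<n}" for i
        using that A sorted_wrt_nth_less[OF strict_sorted_list_of_set, of "i - 1" i A] finA
        by (simp add: enum_set_def)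
      have gap: "?e i + 2 \<le> ?e (Suc i)" if "i \<in> {1..<n}" for i
        using lt[OF that] adj[OF that, of ?e] nz by fastforce
      \<comment> \<open>Truncated subtraction in the definition of the tuple is harmless by this bound.\<close>
      have lower: "2 * i - 1 \<le> ?e i" if "i \<in> {1..n}" for i
        using that
      proof (induction i)
        case (Suc i)
        show ?case
        proof (cases "i = 0")
          case True
          have "?e (Suc i) \<in> A" using bij Suc.prems by (rule bij_betwE[THEN bspec])
          then show ?thesis using A True by auto
        next
          case False
          then show ?thesis using Suc gap[of i] by force
        qed
      qed simp
      define a where "a = map (\<lambda>i. ?e (Suc i) - (2 * i + 1)) [0..<n]"
      have len: "length a = n" by (simp add: a_def)
      have spread: "spread a i = ?e i" if "i \<in> {1..n}" for i
        using that lower[OF that] by (cases i) (auto simp: spread_def a_def)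
      have "sorted a"
        unfolding sorted_iff_nth_Suc
      proof (intro allI impI)
        fix i assume "Suc i < length a"
        then show "a ! i \<le> a ! Suc i"
          using gap[of "Suc i"] by (simp add: a_def)
      qed
      moreover have im: "?im a = A"
        using bij spread by (simp add: bij_betw_def)
      ultimately have "a \<in> ?L" using len A by simp
      then show False using A im by blast
    qed
  qed
  finally show ?thesis by simp
qed

section \<open>Comparing finitely many coefficients\<close>

text \<open>
  Multiplication respects this relation because a coefficient of a product at \<open>a\<close> involves only
  submultisets of \<open>a\<close>.  It reduces an infinite sum to a finite one and infinitely many variables to those
  that occur in \<open>M\<close>.
\<close>
definition agree :: "nat multiset \<Rightarrow> 'a::comm_ring_1 mps \<Rightarrow> 'a mps \<Rightarrow> bool" where
  "agree M f g \<longleftrightarrow> (\<forall>a. a \<subseteq># M \<longrightarrow> mcoeff f a = mcoeff g a)"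

lemma agree_refl [simp]: "agree M f f"
  by (simp add: agree_def)

lemma agree_sym: "agree M f g \<Longrightarrow> agree M g f"
  by (simp add: agree_def)

lemma agree_trans [trans]: "agree M f g \<Longrightarrow> agree M g h \<Longrightarrow> agree M f h"
  by (simp add: agree_def)

lemma agree_mult:
  assumes "agree M f g" "agree M f' g'"
  shows "agree M (f * f') (g * g')"
  unfolding agree_def
proof (intro allI impI)
  fix a assume a: "a \<subseteq># M"
  have "mcoeff f b = mcoeff g b \<and> mcoeff f' (a - b) = mcoeff g' (a - b)" if "b \<subseteq># a" for b
    using assms that a unfolding agree_def
    by (meson diff_subset_eq_self subset_mset.order_trans)
  then show "mcoeff (f * f') a = mcoeff (g * g') a"
    unfolding mcoeff_mult by (intro sum.cong) auto
qed

lemma agree_sum: "(\<And>i. i \<in> A \<Longrightarrow> agree M (f i) (g i)) \<Longrightarrow> agree M (sum f A) (sum g A)"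
  by (simp add: agree_def mcoeff_sum)

lemma agree_prod: "(\<And>i. i \<in> A \<Longrightarrow> agree M (f i) (g i)) \<Longrightarrow> agree M (prod f A) (prod g A)"
  by (induction A rule: infinite_finite_induct) (simp_all add: agree_mult)

lemma agree_leibniz_det:
  assumes "\<And>i j. i \<in> S \<Longrightarrow> j \<in> S \<Longrightarrow> agree M (f i j) (g i j)"
  shows "agree M (leibniz_det S f) (leibniz_det S g)"
  unfolding leibniz_det_def
  by (intro agree_sum agree_mult agree_refl agree_prod) (auto intro!: assms simp: permutes_in_image)

lemma agree_inf_sum:
  assumes "finite J" "J \<subseteq> I" "\<And>i. i \<in> I - J \<Longrightarrow> agree M (f i) 0"
  shows "agree M (inf_sum f I) (sum f J)"
  unfolding agree_def
proof (intro allI impI)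
  fix a assume "a \<subseteq># M"
  then have "{i. i \<in> I \<and> mcoeff (f i) a \<noteq> 0} \<subseteq> J"
    using assms(3) by (auto simp: agree_def)
  then have "(\<Sum>i | i \<in> I \<and> mcoeff (f i) a \<noteq> 0. mcoeff (f i) a) = (\<Sum>i\<in>J. mcoeff (f i) a)"
    by (rule sum.mono_neutral_left[OF assms(1)]) (use assms(2) in auto)
  then show "mcoeff (inf_sum f I) a = mcoeff (sum f J) a"
    by (simp add: inf_sum_def mcoeff_sum)
qed

section \<open>Skew Schur functions as minors\<close>
lemma agree_hsym_hpoly:
  assumes "set_mset M \<subseteq> {..<p}"
  shows "agree M (hsym k) (hpoly p k)"
  unfolding agree_def
proof (intro allI impI)
  fix a assume "a \<subseteq># M"
  then have "set_mset a \<subseteq> {..<p}" using assms set_mset_mono by blast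
  then show "mcoeff (hsym k) a = mcoeff (hpoly p k) a" by (simp add: hsym_def mcoeff_hpoly)
qed

lemma agree_skew_schur:
  assumes p: "set_mset M \<subseteq> {..<p}" and fits: "\<forall>i. part \<mu> i \<le> part lam i"
  shows "agree M (skew_schur lam \<mu>) (tableau_sum p (skew_diagram lam \<mu>))"
  unfolding agree_def
proof (intro allI impI)
  fix a assume "a \<subseteq># M"
  then have a: "set_mset a \<subseteq> {..<p}" using p set_mset_mono by blast
  let ?D = "skew_diagram lam \<mu>"
  let ?c = "\<lambda>T. image_mset T (mset_set ?D)"
  have "{T \<in> ssyt lam \<mu>. ?c T = a} = {T \<in> tableaux p ?D. ?c T = a}"
  proof -
    have "T c < p" if "?c T = a" "c \<in> ?D" for T c
    proof -
      have "T c \<in># a" unfolding that(1)[symmetric] using that(2) by simp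
      then show ?thesis using a by auto
    qed
    then show ?thesis by (auto simp: ssyt_def tableaux_def)
  qed
  moreover have "mcoeff (tableau_sum p ?D) a = (\<Sum>T\<in>tableaux p ?D. if ?c T = a then 1 else 0 :: vpoly)"
    unfolding tableau_sum_def mcoeff_sum by (rule sum.cong) (auto simp: mcoeff_monom)
  moreover have "\<dots> = of_nat (card {T \<in> tableaux p ?D. ?c T = a})"
    by (simp add: sum.inter_filter[symmetric])
  ultimately show "mcoeff (skew_schur lam \<mu>) a = mcoeff (tableau_sum p ?D) a"
    using fits by (simp add: skew_schur_def)
qed

lemma partition_part_decreasing:
  assumes "is_partition \<mu>" "1 \<le> i" "i \<le> j"
  shows "part \<mu> j \<le> part \<mu> i"
  using assms sorted_wrt_nth_less[of "(\<ge>)" \<mu> "i - 1" "j - 1"]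
  by (cases "i = j") (auto simp: is_partition_def part_def)

lemma part_eq_0:
  assumes "is_partition \<mu>" "num_parts \<mu> \<le> N" "N < i"
  shows "part \<mu> i = 0"
proof (rule ccontr)
  assume "part \<mu> i \<noteq> 0"
  then have "{1..i} \<subseteq> {i. part \<mu> i \<noteq> 0}"
    using partition_part_decreasing[OF assms(1)] by fastforce
  moreover have "finite {i. part \<mu> i \<noteq> 0}"
    by (rule finite_subset[of _ "{..length \<mu>}"]) (auto simp: part_def split: if_splits)
  ultimately have "i \<le> num_parts \<mu>"
    unfolding num_parts_def using card_mono[of _ "{1..i}"] by simp
  then show False using assms by simp
qed

text \<open>
  At a fixed monomial only finitely many variables matter, so the identity in \<open>p\<close> variables suffices.
\<close>
lemma jacobi_trudi_hsym:
  assumes lam: "\<And>i. i \<in> {1..N} \<Longrightarrow> part lam (Suc i) \<le> part lam i" "\<And>i. i > N \<Longrightarrow> part lam i = 0"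
    and \<mu>: "\<And>i. i \<in> {1..<N} \<Longrightarrow> part \<mu> (Suc i) \<le> part \<mu> i" "\<And>i. i > N \<Longrightarrow> part \<mu> i = 0"
  shows "skew_schur lam \<mu>
       = leibniz_det {1..N} (\<lambda>i j. hsym (int (part lam i) - int i - (int (part \<mu> j) - int j)))"
proof (rule mps_eqI)
  fix M :: "nat multiset"
  obtain p where p: "set_mset M \<subseteq> {..<p}"
    by (metis finite_nat_set_iff_bounded finite_set_mset lessThan_iff subsetI)
  have fits: "(\<forall>i. part \<mu> i \<le> part lam i) \<longleftrightarrow> (\<forall>i\<in>{1..N}. part \<mu> i \<le> part lam i)"
  proof
    assume *: "\<forall>i\<in>{1..N}. part \<mu> i \<le> part lam i"
    show "\<forall>i. part \<mu> i \<le> part lam i"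
    proof
      fix i show "part \<mu> i \<le> part lam i"
        using * \<mu>(2)[of i] by (cases "i = 0"; cases "i > N") (auto simp: part_def[of _ 0])
    qed
  qed blast
  have diagram: "skew_diagram lam \<mu> = rows_diagram N (part lam) (part \<mu>)"
    using lam(2) by (force simp: skew_diagram_def rows_diagram_def not_le[symmetric])
  let ?P = "leibniz_det {1..N} (\<lambda>i j. hpoly p (int (part lam i) - int i - (int (part \<mu> j) - int j))) :: symfun"
  have "agree M (skew_schur lam \<mu>) (if \<forall>i\<in>{1..N}. part \<mu> i \<le> part lam i
      then tableau_sum p (rows_diagram N (part lam) (part \<mu>)) else 0)"
  proof (cases "\<forall>i. part \<mu> i \<le> part lam i")
    case True
    then show ?thesis using agree_skew_schur[OF p True] by (simp add: diagram)
  next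
    case False
    then have "skew_schur lam \<mu> = 0" unfolding skew_schur_def by (rule if_not_P)
    then show ?thesis using False fits by (simp only: if_False agree_refl)
  qed
  also have "\<dots> = ?P"
    by (rule jacobi_trudi[symmetric]) (use assms in auto)
  also have "agree M ?P (leibniz_det {1..N} (\<lambda>i j. hsym (int (part lam i) - int i - (int (part \<mu> j) - int j))))"
    by (rule agree_leibniz_det) (rule agree_sym, rule agree_hsym_hpoly[OF p])
  finally show "mcoeff (skew_schur lam \<mu>) M
      = mcoeff (leibniz_det {1..N} (\<lambda>i j. hsym (int (part lam i) - int i - (int (part \<mu> j) - int j)))) M"
    by (simp add: agree_def)
qed

lemma nth_concat_doubled:
  "i < 2 * length xs \<Longrightarrow> concat (map (\<lambda>x. [x, x]) xs) ! i = xs ! (i div 2)"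
proof (induction xs arbitrary: i)
  case (Cons x xs)
  consider "i = 0" | "i = 1" | k where "i = Suc (Suc k)"
    by (metis One_nat_def not0_implies_Suc)
  then show ?case using Cons by cases auto
qed simp

lemma part_doubled:
  assumes "length a = n" "i \<in> {1..2 * n}"
  shows "part (doubled a) i = a ! (n - (i + 1) div 2)"
proof -
  have "length (concat (map (\<lambda>x. [x, x]) xs)) = 2 * length xs" for xs :: "nat list"
    by (induction xs) auto
  then have "part (doubled a) i = concat (map (\<lambda>x. [x, x]) (rev a)) ! (i - 1)"
    using assms by (simp add: part_def doubled_def)
  also have "\<dots> = rev a ! ((i - 1) div 2)"
    by (rule nth_concat_doubled) (use assms in auto)
  also have "\<dots> = a ! (n - Suc ((i - 1) div 2))"
    using assms by (subst rev_nth) auto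
  also have "Suc ((i - 1) div 2) = (i + 1) div 2" using assms by (cases i) auto
  finally show ?thesis .
qed

lemma part_doubled_beyond: "length a = n \<Longrightarrow> 2 * n < i \<Longrightarrow> part (doubled a) i = 0"
proof -
  have "length (concat (map (\<lambda>x. [x, x]) xs)) = 2 * length xs" for xs :: "nat list"
    by (induction xs) auto
  then show "length a = n \<Longrightarrow> 2 * n < i \<Longrightarrow> part (doubled a) i = 0"
    by (simp add: part_def doubled_def)
qed

text \<open>
  Read from the last row upwards, the parts of \<open>(a\<^sub>n, a\<^sub>n, \<dots>, a\<^sub>1, a\<^sub>1)\<close> increased by \<open>1, 2, \<dots>, 2n\<close> are the
  chosen columns: the two equal parts become adjacent columns.
\<close>
lemma pair_columns_spread:
  assumes "length a = n" "i \<in> {1..2 * n}"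
  shows "pair_columns (spread a) (2 * n + 1 - i) = part (doubled a) i + (2 * n + 1 - i)"
proof (cases "even i")
  case True
  then obtain t where t: "i = 2 * t" by blast
  define r where "r = n - t + 1"
  have r: "2 * n + 1 - i = 2 * r - 1" "r \<ge> 1" "r - 1 = n - t" "n - (i + 1) div 2 = n - t"
    using assms t by (auto simp: r_def)
  show ?thesis unfolding r(1) part_doubled[OF assms] r(4)
    using r(2,3) by (simp add: pair_columns_odd spread_def)
next
  case False
  define t where "t = (i + 1) div 2"
  define r where "r = n - t + 1"
  have t: "i = 2 * t - 1" using False by (auto simp: t_def elim!: oddE)
  have r: "2 * n + 1 - i = 2 * r" "r \<ge> 1" "r - 1 = n - t"
    using assms t by (auto simp: r_def)
  show ?thesis unfolding r(1) part_doubled[OF assms] t_def[symmetric]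
    using r(2,3) by (simp add: pair_columns_even spread_def)
qed

text \<open>
  The matrix of the theorem is the Jacobi-Trudi matrix with rows and columns in reverse
  order.  Reversing both does not change the determinant.
\<close>
lemma skew_schur_doubled_eq_pair_minor:
  assumes \<mu>: "is_partition \<mu>" "num_parts \<mu> \<le> 2 * n"
    and a: "length a = n" "sorted a"
  shows "skew_schur (doubled a) \<mu> = pair_minor n (Hmat (2 * n) \<mu>) (spread a)"
proof -
  let ?N = "2 * n"
  \<comment> \<open>The reversal of the index range.\<close>
  define \<rho> where "\<rho> i = (if i \<in> {1..?N} then ?N + 1 - i else i)" for i
  have "bij_betw \<rho> {1..?N} {1..?N}"
    by (rule bij_betw_byWitness[where f' = \<rho>]) (auto simp: \<rho>_def)
  then have \<rho>: "\<rho> permutes {1..?N}"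
    by (rule bij_imp_permutes) (auto simp: \<rho>_def)
  have "skew_schur (doubled a) \<mu> = leibniz_det {1..?N}
      (\<lambda>i j. hsym (int (part (doubled a) i) - int i - (int (part \<mu> j) - int j)))"
  proof (rule jacobi_trudi_hsym)
    fix i assume i: "i \<in> {1..?N}"
    show "part (doubled a) (Suc i) \<le> part (doubled a) i"
    proof (cases "i = ?N")
      case False
      then have "Suc i \<in> {1..?N}" using i by simp
      then show ?thesis
        using i a by (simp only: part_doubled[OF a(1)]) (auto intro!: sorted_nth_mono)
    qed (simp add: part_doubled_beyond[OF a(1)])
  qed (use partition_part_decreasing[OF \<mu>(1)] part_eq_0[OF \<mu>] part_doubled_beyond[OF a(1)] in auto)
  also have "\<dots> = leibniz_det {1..?N} (\<lambda>i j. Hmat ?N \<mu> (\<rho> j) (pair_columns (spread a) (\<rho> i)))"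
  proof (rule leibniz_det_cong)
    fix i j assume i: "i \<in> {1..?N}" and j: "j \<in> {1..?N}"
    have "\<rho> i = ?N + 1 - i" "\<rho> j = ?N + 1 - j" "?N - \<rho> j + 1 = j" using i j by (auto simp: \<rho>_def)
    then show "hsym (int (part (doubled a) i) - int i - (int (part \<mu> j) - int j))
        = Hmat ?N \<mu> (\<rho> j) (pair_columns (spread a) (\<rho> i))"
      using pair_columns_spread[OF a(1) i] i j by (simp add: Hmat_def algebra_simps)
  qed
  also have "\<dots> = pair_minor n (Hmat ?N \<mu>) (spread a)"
    by (rule leibniz_det_conjugate[OF finite_atLeastAtMost \<rho>])
  finally show ?thesis .
qed

section \<open>The Pfaffian formula\<close>
lemma scalar_1: "scalar 1 = 1"
  by (simp add: scalar_def const_mps_1)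

lemma scalar_mult: "scalar (c * d) = scalar c * scalar d"
  by (simp add: scalar_def Poly_Mapping.mult_single flip: const_mps_mult)

lemma scalar_of_nat: "scalar (of_nat k) = of_nat k"
proof (induction k)
  case 0
  show ?case by (rule mps_eqI) (simp add: scalar_def const_mps_def)
next
  case (Suc k)
  have "scalar (c + d) = scalar c + scalar d" for c d
    by (rule mps_eqI) (simp add: scalar_def const_mps_def plus_mps_def Poly_Mapping.single_add)
  then show ?case using Suc by (simp add: scalar_1)
qed

text \<open>
  The coefficients of \<open>M\<close> see only the columns before \<open>K\<close>.  Up to those coefficients the
  triple product is the antisymmetrization of a matrix to which only the entries of \<open>Omega\<close>
  above the diagonal contribute.
\<close>
lemma agree_Hmat_Omega_Hmat:
  assumes zero: "\<And>k. k \<ge> K \<Longrightarrow> agree M (H p k) 0 \<and> agree M (H q k) 0"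
  shows "agree M (mat_mul (mat_mul H Omega) (mat_transpose H) p q)
    ((\<Sum>k\<in>{1..<K}. vvar k * (H p k * H q (Suc k))) - (\<Sum>k\<in>{1..<K}. vvar k * (H q k * H p (Suc k))))"
proof -
  have zero_mult: "agree M (f * g) 0" if "agree M f 0" for f g :: symfun
    using agree_mult[OF that, of g g] by simp
  have "agree M (mat_mul (mat_mul H Omega) (mat_transpose H) p q)
      (\<Sum>l\<in>{1..K}. mat_mul H Omega p l * H q l)"
    unfolding mat_mul_def[of "mat_mul H Omega"] mat_transpose_def
  proof (rule agree_inf_sum)
    fix l assume "l \<in> {1..} - {1..K}"
    then show "agree M (mat_mul H Omega p l * H q l) 0"
      using zero[of l] zero_mult by (subst mult.commute) auto
  qed auto
  also have "agree M \<dots> (\<Sum>l\<in>{1..K}. (\<Sum>k\<in>{1..K}. H p k * Omega k l) * H q l)"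
  proof (intro agree_sum agree_mult agree_refl)
    fix l
    show "agree M (mat_mul H Omega p l) (\<Sum>k\<in>{1..K}. H p k * Omega k l)"
      unfolding mat_mul_def by (rule agree_inf_sum) (use zero zero_mult in auto)
  qed
  also have "(\<Sum>l\<in>{1..K}. (\<Sum>k\<in>{1..K}. H p k * Omega k l) * H q l)
      = (\<Sum>l\<in>{1..K}. \<Sum>k\<in>{1..K}. (if l = Suc k then vvar k * (H p k * H q (Suc k)) else 0))
      - (\<Sum>l\<in>{1..K}. \<Sum>k\<in>{1..K}. (if k = Suc l then vvar l * (H q l * H p (Suc l)) else 0))"
    unfolding sum_subtractf[symmetric] sum_distrib_right
    by (intro sum.cong refl) (auto simp: Omega_def algebra_simps)
  also have "(\<Sum>l\<in>{1..K}. \<Sum>k\<in>{1..K}. (if l = Suc k then vvar k * (H p k * H q (Suc k)) else 0))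
      = (\<Sum>k\<in>{1..K}. if k < K then vvar k * (H p k * H q (Suc k)) else 0)"
    by (subst sum.swap) (rule sum.cong, auto)
  also have "\<dots> = (\<Sum>k\<in>{1..<K}. vvar k * (H p k * H q (Suc k)))"
    by (rule sum.mono_neutral_cong_right) auto
  also have "(\<Sum>l\<in>{1..K}. \<Sum>k\<in>{1..K}. (if k = Suc l then vvar l * (H q l * H p (Suc l)) else 0))
      = (\<Sum>k\<in>{1..K}. if k < K then vvar k * (H q k * H p (Suc k)) else 0)"
    by (rule sum.cong) auto
  also have "\<dots> = (\<Sum>k\<in>{1..<K}. vvar k * (H q k * H p (Suc k)))"
    by (rule sum.mono_neutral_cong_right) auto
  finally show ?thesis .
qed

lemma agree_Hmat_0:
  assumes "size M + r + part \<mu> (N - r + 1) < k"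
  shows "agree M (Hmat N \<mu> r k) 0"
  unfolding agree_def
proof (intro allI impI)
  fix a assume "a \<subseteq># M"
  then have "size a \<le> size M" by (rule size_mset_mono)
  then show "mcoeff (Hmat N \<mu> r k) a = mcoeff 0 a" using assms by (auto simp: Hmat_def hsym_def)
qed

theorem theorem3p3:
  fixes n :: nat and \<mu> :: "nat list"
  assumes "n \<ge> 1"
    and "is_partition \<mu>"
    and "num_parts \<mu> \<le> 2 * n"
  shows "pfaffian n
           (mat_mul (mat_mul (Hmat (2 * n) \<mu>) Omega) (mat_transpose (Hmat (2 * n) \<mu>)))
         = inf_sum
             (\<lambda>a. skew_schur (doubled a) \<mu> * (\<Prod>r = 1..n. vvar (a ! (r - 1) + 2 * r - 1)))
             {a. length a = n \<and> sorted a}"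
proof (rule mps_eqI)
  fix M :: "nat multiset"
  let ?H = "Hmat (2 * n) \<mu>"
  let ?Q = "mat_mul (mat_mul ?H Omega) (mat_transpose ?H)"
  let ?f = "\<lambda>a. skew_schur (doubled a) \<mu> * (\<Prod>r = 1..n. vvar (a ! (r - 1) + 2 * r - 1))"
  define F where "F \<kappa> = (\<Prod>i\<in>{1..n}. vvar (\<kappa> i)) * pair_minor n ?H \<kappa>" for \<kappa>
  \<comment> \<open>All columns from \<open>K\<close> on have entries of degree larger than \<open>size M\<close>, in every row.\<close>
  define K where "K = Suc (size M + (\<Sum>r\<in>{1..2 * n}. r + part \<mu> (2 * n - r + 1)))"
  define A where "A p q = (\<Sum>k\<in>{1..<K}. vvar k * (?H p k * ?H q (Suc k)))" for p q
  let ?L = "{a. length a = n \<and> sorted a \<and> spread a ` {1..n} \<subseteq> {1..<K}}"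
  have f: "?f a = F (spread a)" if "length a = n" "sorted a" for a
    using skew_schur_doubled_eq_pair_minor[OF assms(2,3) that]
    by (simp add: F_def spread_def mult.commute)
  have zero: "agree M (?H r k) 0" if "r \<in> {1..2 * n}" "k \<ge> K" for r k
  proof (rule agree_Hmat_0)
    have "r + part \<mu> (2 * n - r + 1) \<le> (\<Sum>r\<in>{1..2 * n}. r + part \<mu> (2 * n - r + 1))"
      using that(1) by (intro member_le_sum) auto
    then show "size M + r + part \<mu> (2 * n - r + 1) < k" using that(2) by (simp add: K_def)
  qed
  have "agree M (\<Sum>\<sigma> | \<sigma> permutes {1..2 * n}. of_int (sign \<sigma>) * (\<Prod>i = 1..n. ?Q (\<sigma> (2 * i - 1)) (\<sigma> (2 * i))))
      (\<Sum>\<sigma> | \<sigma> permutes {1..2 * n}. of_int (sign \<sigma>) *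
        (\<Prod>i\<in>{1..n}. A (\<sigma> (2 * i - 1)) (\<sigma> (2 * i)) - A (\<sigma> (2 * i)) (\<sigma> (2 * i - 1))))"
  proof (intro agree_sum agree_mult agree_refl agree_prod)
    fix \<sigma> i assume "\<sigma> \<in> {\<sigma>. \<sigma> permutes {1..2 * n}}" and i: "i \<in> {1..n}"
    then have \<sigma>: "\<sigma> permutes {1..2 * n}" by simp
    have rows: "\<sigma> (2 * i - 1) \<in> {1..2 * n}" "\<sigma> (2 * i) \<in> {1..2 * n}"
      unfolding permutes_in_image[OF \<sigma>] using i by auto
    show "agree M (?Q (\<sigma> (2 * i - 1)) (\<sigma> (2 * i)))
        (A (\<sigma> (2 * i - 1)) (\<sigma> (2 * i)) - A (\<sigma> (2 * i)) (\<sigma> (2 * i - 1)))"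
      unfolding A_def by (intro agree_Hmat_Omega_Hmat conjI zero rows)
  qed
  also have "(\<Sum>\<sigma> | \<sigma> permutes {1..2 * n}. of_int (sign \<sigma>) *
        (\<Prod>i\<in>{1..n}. A (\<sigma> (2 * i - 1)) (\<sigma> (2 * i)) - A (\<sigma> (2 * i)) (\<sigma> (2 * i - 1))))
      = 2 ^ n * (\<Sum>\<kappa>\<in>{1..n} \<rightarrow>\<^sub>E {1..<K}. F \<kappa>)"
    unfolding signed_sum_antisymmetrized unfolding A_def F_def
    by (simp only: signed_sum_pair_minors[OF finite_atLeastLessThan])
  also have "(\<Sum>\<kappa>\<in>{1..n} \<rightarrow>\<^sub>E {1..<K}. F \<kappa>)
      = of_nat (fact n) * (\<Sum>B | B \<subseteq> {1..<K} \<and> card B = n. F (enum_set B))"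
  proof (rule sum_symmetric_functions)
    show "F \<kappa> = F \<kappa>'" if "\<And>i. i \<in> {1..n} \<Longrightarrow> \<kappa> i = \<kappa>' i" for \<kappa> \<kappa>'
      unfolding F_def using that
      by (intro arg_cong2[where f = "(*)"] prod.cong refl pair_minor_cong) auto
    show "F (\<kappa> \<circ> \<pi>) = F \<kappa>" if "\<pi> permutes {1..n}" for \<kappa> \<pi>
      unfolding F_def pair_minor_permute[OF that]
      using prod.permute[OF that, of "\<lambda>i. vvar (\<kappa> i)"] by (simp add: comp_def)
    show "F \<kappa> = 0" if not_inj: "\<not> inj_on \<kappa> {1..n}" for \<kappa>
    proof -
      obtain i j where "i \<in> {1..n}" "j \<in> {1..n}" "i \<noteq> j" "\<kappa> i = \<kappa> j"
        using not_inj unfolding inj_on_def by blast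
      then have "pair_minor n ?H \<kappa> = 0" by (intro pair_minor_eq_0[of i n j]) auto
      then show ?thesis by (simp only: F_def mult_zero_right)
    qed
  qed simp
  also have "(\<Sum>B | B \<subseteq> {1..<K} \<and> card B = n. F (enum_set B)) = (\<Sum>a\<in>?L. F (spread a))"
  proof (rule sum_subsets_without_adjacent)
    show "F \<kappa> = F \<kappa>'" if "\<And>i. i \<in> {1..n} \<Longrightarrow> \<kappa> i = \<kappa>' i" for \<kappa> \<kappa>'
      unfolding F_def using that
      by (intro arg_cong2[where f = "(*)"] prod.cong refl pair_minor_cong) auto
    show "F \<kappa> = 0" if "i \<in> {1..<n}" "\<kappa> (Suc i) = Suc (\<kappa> i)" for \<kappa> i
    proof -
      have "pair_minor n ?H \<kappa> = 0" using that by (intro pair_minor_eq_0[of "Suc i" n i]) auto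
      then show ?thesis by (simp only: F_def mult_zero_right)
    qed
  qed
  finally have sum: "agree M
      (\<Sum>\<sigma> | \<sigma> permutes {1..2 * n}. of_int (sign \<sigma>) * (\<Prod>i = 1..n. ?Q (\<sigma> (2 * i - 1)) (\<sigma> (2 * i))))
      (2 ^ n * (of_nat (fact n) * (\<Sum>a\<in>?L. F (spread a))))" .
  \<comment> \<open>The factors \<open>2 ^ n\<close> and \<open>n!\<close> are the denominator in the definition of the Pfaffian.\<close>
  have "agree M (pfaffian n ?Q)
      (scalar (1 / (2 ^ n * fact n)) * (2 ^ n * (of_nat (fact n) * (\<Sum>a\<in>?L. F (spread a)))))"
    unfolding pfaffian_def by (rule agree_mult[OF agree_refl sum])
  also have "scalar (1 / (2 ^ n * fact n)) * (2 ^ n * (of_nat (fact n) * (\<Sum>a\<in>?L. F (spread a))))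
      = scalar (1 / (2 ^ n * fact n)) * scalar (of_nat (2 ^ n * fact n)) * (\<Sum>a\<in>?L. F (spread a))"
    unfolding scalar_of_nat by (simp only: of_nat_mult of_nat_power of_nat_numeral mult.assoc)
  also have "scalar (1 / (2 ^ n * fact n)) * scalar (of_nat (2 ^ n * fact n)) = 1"
    unfolding scalar_mult[symmetric] by (simp add: scalar_1)
  also have "1 * (\<Sum>a\<in>?L. F (spread a)) = (\<Sum>a\<in>?L. ?f a)"
    unfolding mult_1_left by (rule sum.cong) (use f in auto)
  also have "agree M (\<Sum>a\<in>?L. ?f a) (inf_sum ?f {a. length a = n \<and> sorted a})"
  proof (rule agree_sym, rule agree_inf_sum)
    have "set a \<subseteq> {..K}" if a: "a \<in> ?L" for a
    proof
      fix x assume "x \<in> set a"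
      then obtain i where i: "i < length a" "x = a ! i" by (metis in_set_conv_nth)
      then have "spread a (Suc i) \<in> spread a ` {1..n}" using a by simp
      then have "spread a (Suc i) < K" using a by auto
      then show "x \<in> {..K}" using i by (simp add: spread_def)
    qed
    then have "?L \<subseteq> {a. set a \<subseteq> {..K} \<and> length a = n}" by blast
    then show "finite ?L" by (rule finite_subset) (simp add: finite_lists_length_eq)
    fix a assume a: "a \<in> {a. length a = n \<and> sorted a} - ?L"
    then obtain r where r: "r \<in> {1..n}" "spread a r \<notin> {1..<K}" by blast
    then have "spread a r \<ge> K" by (auto simp: spread_def)
    \<comment> \<open>A tuple outside the finite range uses a column from \<open>K\<close> on, which does not contribute.\<close>
    have "agree M (pair_minor n ?H (spread a))
        (leibniz_det {1..2 * n} ((\<lambda>q s. ?H s (pair_columns (spread a) q))(2 * r := (\<lambda>_. 0))))"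
    proof (rule agree_leibniz_det)
      fix q s assume s: "s \<in> {1..2 * n}"
      show "agree M (?H s (pair_columns (spread a) q))
          (((\<lambda>q s. ?H s (pair_columns (spread a) q))(2 * r := (\<lambda>_. 0))) q s)"
        using zero[OF s, of "pair_columns (spread a) (2 * r)"] \<open>spread a r \<ge> K\<close>
        by (simp add: pair_columns_even)
    qed
    also have "leibniz_det {1..2 * n} ((\<lambda>q s. ?H s (pair_columns (spread a) q))(2 * r := (\<lambda>_. 0))) = 0"
      using r(1) by (intro leibniz_det_zero_row[where a = "2 * r"]) auto
    finally have "agree M (F (spread a)) ((\<Prod>i\<in>{1..n}. vvar (spread a i)) * 0)"
      unfolding F_def by (intro agree_mult agree_refl)
    then show "agree M (?f a) 0" using a f by simp
  qed auto
  finally show "mcoeff (pfaffian n ?Q) M = mcoeff (inf_sum ?f {a. length a = n \<and> sorted a}) M"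
    by (simp add: agree_def)
qed

end
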